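(* Let $(\mathcal{M}_q)_{q\ge 1}$, $f^\star$, $q^\star$ and $(X_k)_{k\ge1}$ be as in the context. Suppose that there are a constant $K\ge1$ and a strictly increasing function $\eta(q)\ge q$ such that $$\mathcal{N}(\mathcal{H}_q(\varepsilon),\delta)\le\left(\frac{K\varepsilon}{\delta}\right)^{\eta(q)}\qquad\text{for all }q\ge q^\star\text{ and all }0<\delta\le\varepsilon .$$ Define the penalty $\mathrm{pen}(n,q)=\eta(q)\,\varpi(n)$, where $\varpi(n)>0$ is any function such that $$\lim_{n\to\infty}\frac{\log\log n}{\varpi(n)}=0,\qquad \lim_{n\to\infty}\frac{\varpi(n)}{n}=0 .$$ Then the penalized likelihood order estimator $$\hat q_n=\operatorname*{argmax}_{q\ge1}\left\{\sup_{f\in\mathcal{M}_q}\ell_n(f)-\mathrm{pen}(n,q)\right\}$$ satisfies $\hat q_n\to q^\star$ as $n\to\infty$, $\mathbf{P}^\star$-a.s.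
   Context: Setting. $(E,\mathcal{E},\mu)$ is a measure space and $(\mathcal{M}_q)_{q\ge1}$ are families of strictly positive ($\mu$-a.e.) probability densities with respect to $\mu$ with $\mathcal{M}_q\subseteq\mathcal{M}_{q+1}$ for all $q$. Fix $q^\star\ge1$ and $f^\star\in\mathcal{M}_{q^\star}\setminus\operatorname{cl}\mathcal{M}_{q^\star-1}$, where $\operatorname{cl}$ is the closure in $L^1(d\mu)$ (and $\mathcal{M}_0=\varnothing$). Under $\mathbf{P}^\star$, $(X_k)_{k\ge1}$ are i.i.d. $E$-valued random variables with law $f^\star d\mu$. Notation. $\ell_n(f)=\sum_{i=1}^n\log f(X_i)$. $\|\cdot\|_2$ is the $L^2(f^\star d\mu)$-norm. $h(f,g)^2=\int(\sqrt f-\sqrt g)^2d\mu$. For $\varepsilon>0$, $\mathcal{H}_q(\varepsilon)=\{\sqrt{f/f^\star}: f\in\mathcal{M}_q,\ h(f,f^\star)\le\varepsilon\}$. For a class of functions $\mathcal{Q}$ and $\delta>0$, $\mathcal{N}(\mathcal{Q},\delta)$ is the smallest $N$ for which there are pairs $\{g_i^L,g_i^U\}_{i\le N}$ with $\max_i\|g_i^U-g_i^L\|_2\le\delta$ such that every $g\in\mathcal{Q}$ satisfies $g_i^L\le g\le g_i^U$ pointwise for some $i$. Conventions: uncountable suprema of random variables are essential suprema with respect to $\mathbf{P}^\star$. The maximum defining $\hat q_n$ is over all integers $q\ge1$; since $\hat q_n$ is integer valued, $\hat q_n\to q^\star$ a.s. means that almost surely, for all sufficiently large $n$, $q^\star$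 is the unique maximizer. *)

theory Defs
  imports "HOL-Probability.Probability"
begin

definition pos_prob_density :: "'a measure \<Rightarrow> ('a \<Rightarrow> real) \<Rightarrow> bool" where
  "pos_prob_density M f \<longleftrightarrow>
     f \<in> borel_measurable M \<and> (AE x in M. 0 < f x) \<and>
     integrable M f \<and> (\<integral>x. f x \<partial>M) = 1"

definition L1_closure :: "'a measure \<Rightarrow> ('a \<Rightarrow> real) set \<Rightarrow> ('a \<Rightarrow> real) set" where
  "L1_closure M S =
     {f. integrable M f \<and>
         (\<forall>\<epsilon>>0. \<exists>g\<in>S. integrable M g \<and> (\<integral>x. \<bar>f x - g x\<bar> \<partial>M) < \<epsilon>)}"

definition hellinger :: "'a measure \<Rightarrow> ('a \<Rightarrow> real) \<Rightarrow> ('a \<Rightarrow> real) \<Rightarrow> real" where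
  "hellinger M f g = sqrt (\<integral>x. (sqrt (f x) - sqrt (g x))\<^sup>2 \<partial>M)"

definition hellinger_ball ::
  "'a measure \<Rightarrow> ('a \<Rightarrow> real) \<Rightarrow> ('a \<Rightarrow> real) set \<Rightarrow> real \<Rightarrow> ('a \<Rightarrow> real) set" where
  "hellinger_ball M f\<^sub>0 \<F> \<epsilon> = {(\<lambda>x. sqrt (f x / f\<^sub>0 x)) |f. f \<in> \<F> \<and> hellinger M f f\<^sub>0 \<le> \<epsilon>}"

definition L2_norm :: "'a measure \<Rightarrow> ('a \<Rightarrow> real) \<Rightarrow> real" where
  "L2_norm \<nu> g = sqrt (\<integral>x. (g x)\<^sup>2 \<partial>\<nu>)"

text \<open>
  The integrability condition is needed because the Bochner integral of a non-integrable
  function is 0; it says that the width of a bracket has a finite norm.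
\<close>

definition bracket_cover :: "'a measure \<Rightarrow> ('a \<Rightarrow> real) set \<Rightarrow> real \<Rightarrow> nat \<Rightarrow> bool" where
  "bracket_cover \<nu> Q \<delta> N \<longleftrightarrow>
     (\<exists>gL gU :: nat \<Rightarrow> 'a \<Rightarrow> real.
        (\<forall>i<N. gL i \<in> borel_measurable \<nu> \<and> gU i \<in> borel_measurable \<nu> \<and>
               integrable \<nu> (\<lambda>x. (gU i x - gL i x)\<^sup>2) \<and>
               L2_norm \<nu> (\<lambda>x. gU i x - gL i x) \<le> \<delta>) \<and>
        (\<forall>g\<in>Q. \<exists>i<N. \<forall>x\<in>space \<nu>. gL i x \<le> g x \<and> g x \<le> gU i x))"

text \<open>The bracketing number is \<open>\<infinity>\<close> if there is no finite cover.\<close>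

definition bracketing_number :: "'a measure \<Rightarrow> ('a \<Rightarrow> real) set \<Rightarrow> real \<Rightarrow> enat" where
  "bracketing_number \<nu> Q \<delta> = Inf {enat N |N. bracket_cover \<nu> Q \<delta> N}"

text \<open>
  The essential supremum of a family of random variables is again a random variable, unique up
  to almost sure equality; it is not the number \<open>esssup\<close> of the library, which is
  attached to a single function.
\<close>

definition is_fam_esssup ::
  "'w measure \<Rightarrow> 'i set \<Rightarrow> ('i \<Rightarrow> 'w \<Rightarrow> ereal) \<Rightarrow> ('w \<Rightarrow> ereal) \<Rightarrow> bool" where
  "is_fam_esssup P I Z Y \<longleftrightarrow>
     Y \<in> borel_measurable P \<and>
     (\<forall>i\<in>I. AE \<omega> in P. Z i \<omega> \<le> Y \<omega>) \<and>
     (\<forall>Y'\<in>borel_measurable P. (\<forall>i\<in>I. AE \<omega> in P. Z i \<omega> \<le> Y' \<omega>) \<longrightarrow>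
        (AE \<omega> in P. Y \<omega> \<le> Y' \<omega>))"

definition fam_esssup ::
  "'w measure \<Rightarrow> 'i set \<Rightarrow> ('i \<Rightarrow> 'w \<Rightarrow> ereal) \<Rightarrow> 'w \<Rightarrow> ereal" where
  "fam_esssup P I Z = (SOME Y. is_fam_esssup P I Z Y)"

lemma is_fam_esssup_unique:
  assumes "is_fam_esssup P I Z Y" "is_fam_esssup P I Z Y'"
  shows "AE \<omega> in P. Y \<omega> = Y' \<omega>"
proof -
  have "AE \<omega> in P. Y \<omega> \<le> Y' \<omega>" "AE \<omega> in P. Y' \<omega> \<le> Y \<omega>"
    using assms unfolding is_fam_esssup_def by blast+
  then show ?thesis by eventually_elim auto
qed

lemma (in prob_space) is_fam_esssup_fam_esssup:
  assumes Z: "\<And>i. i \<in> I \<Longrightarrow> Z i \<in> borel_measurable M"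
  shows "is_fam_esssup M I Z (fam_esssup M I Z)"
proof -
  define \<phi> :: "ereal \<Rightarrow> real" where
    "\<phi> x = (if x = \<infinity> then pi/2 else if x = -\<infinity> then -pi/2 else arctan (real_of_ereal x))" for x
  have \<phi>_meas [measurable]: "\<phi> \<in> borel_measurable borel"
    unfolding \<phi>_def by measurable
  have \<phi>_less: "\<phi> x < \<phi> y" if "x < y" for x y
    using that arctan_lbound arctan_ubound pi_gt_zero
    by (cases x; cases y) (auto simp: \<phi>_def arctan_less_iff)
  have \<phi>_le: "\<phi> x \<le> \<phi> y" if "x \<le> y" for x y
    using that \<phi>_less[of x y] by (cases "x = y") (auto simp: order_le_less)
  have \<phi>_bd: "\<bar>\<phi> x\<bar> \<le> pi/2" for x
    using arctan_lbound[of "real_of_ereal x"] arctan_ubound[of "real_of_ereal x"] pi_gt_zero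
    by (auto simp: \<phi>_def abs_le_iff intro: less_imp_le)
  define S where "S J \<omega> = (SUP i\<in>J. Z i \<omega>)" for J \<omega>
  define c where "c J = expectation (\<lambda>\<omega>. \<phi> (S J \<omega>))" for J
  define \<J> where "\<J> = {J. J \<subseteq> I \<and> countable J}"
  have S_meas [measurable]: "S J \<in> borel_measurable M" if "J \<in> \<J>" for J
    using that Z unfolding S_def \<J>_def by (intro borel_measurable_SUP) auto
  have int: "integrable M (\<lambda>\<omega>. \<phi> (S J \<omega>))" if "J \<in> \<J>" for J
    using \<phi>_bd S_meas[OF that] by (intro integrable_const_bound[where B="pi/2"]) auto
  have c_mono: "c J \<le> c K" if "J \<subseteq> K" "J \<in> \<J>" "K \<in> \<J>" for J K
    unfolding c_def using that
    by (intro integral_mono int \<phi>_le) (auto simp: S_def intro: SUP_subset_mono)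
  have c_bd: "c J \<le> pi/2" if "J \<in> \<J>" for J
  proof -
    have "c J \<le> expectation (\<lambda>_. pi/2)"
      unfolding c_def by (intro integral_mono int that) (auto intro: abs_le_D1[OF \<phi>_bd, simplified])
    then show ?thesis by (simp add: prob_space)
  qed
  have ne: "c ` \<J> \<noteq> {}" by (auto simp: \<J>_def)
  have bdd: "bdd_above (c ` \<J>)" using c_bd by (intro bdd_aboveI[where M="pi/2"]) blast
  have "\<exists>J\<in>\<J>. Sup (c ` \<J>) - 1 / Suc n < c J" for n
    using less_cSup_iff[OF ne bdd, of "Sup (c ` \<J>) - 1 / Suc n"] by auto
  then obtain J where J: "\<And>n. J n \<in> \<J>" "\<And>n. Sup (c ` \<J>) - 1 / Suc n < c (J n)"
    by metis
  define K where "K = (\<Union>n. J n)"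
  have K: "K \<in> \<J>" using J(1) by (auto simp: K_def \<J>_def)
  have "Sup (c ` \<J>) \<le> c K"
  proof (rule field_le_epsilon)
    fix e :: real assume "0 < e"
    then obtain n where n: "1 / Suc n < e" by (metis nat_approx_posE)
    have "c (J n) \<le> c K" using J(1) K by (intro c_mono) (auto simp: K_def)
    then show "Sup (c ` \<J>) \<le> c K + e" using J(2)[of n] n by linarith
  qed
  then have K_max: "c L \<le> c K" if "L \<in> \<J>" for L
    using cSup_upper[OF _ bdd, of "c L"] that by auto
  have "is_fam_esssup M I Z (S K)"
    unfolding is_fam_esssup_def
  proof (intro conjI ballI impI)
    show "S K \<in> borel_measurable M" using K by measurable
  next
    fix i assume i: "i \<in> I"
    have L: "insert i K \<in> \<J>" using i K by (auto simp: \<J>_def)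
    let ?d = "\<lambda>\<omega>. \<phi> (S (insert i K) \<omega>) - \<phi> (S K \<omega>)"
    have nonneg: "0 \<le> ?d \<omega>" for \<omega>
      using \<phi>_le[of "S K \<omega>" "S (insert i K) \<omega>"] by (auto simp: S_def)
    have "expectation ?d = c (insert i K) - c K"
      unfolding c_def by (intro Bochner_Integration.integral_diff int K L)
    also have "\<dots> \<le> 0" using K_max[OF L] by simp
    finally have "expectation ?d = 0"
      using Bochner_Integration.integral_nonneg[of M ?d] nonneg by (meson order_antisym)
    then have "AE \<omega> in M. ?d \<omega> = 0"
      using integral_nonneg_eq_0_iff_AE[of M ?d] int K L nonneg by auto
    then show "AE \<omega> in M. Z i \<omega> \<le> S K \<omega>"
    proof eventually_elim
      case (elim \<omega>)
      have "Z i \<omega> \<le> S (insert i K) \<omega>" by (auto simp: S_def)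
      moreover have "\<not> S K \<omega> < S (insert i K) \<omega>" using elim \<phi>_less by fastforce
      ultimately show ?case by simp
    qed
  next
    fix Y' assume *: "\<forall>i\<in>I. AE \<omega> in M. Z i \<omega> \<le> Y' \<omega>"
    have "AE \<omega> in M. \<forall>i\<in>K. Z i \<omega> \<le> Y' \<omega>"
      using K * by (subst AE_ball_countable) (auto simp: \<J>_def)
    then show "AE \<omega> in M. S K \<omega> \<le> Y' \<omega>"
      by eventually_elim (auto simp: S_def intro: SUP_least)
  qed
  then show ?thesis unfolding fam_esssup_def by (rule someI[where P="is_fam_esssup M I Z"])
qed

definition loglik :: "(nat \<Rightarrow> 'w \<Rightarrow> 'a) \<Rightarrow> nat \<Rightarrow> ('a \<Rightarrow> real) \<Rightarrow> 'w \<Rightarrow> real" where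
  "loglik X n f \<omega> = (\<Sum>i=1..n. ln (f (X i \<omega>)))"

definition sup_loglik ::
  "'w measure \<Rightarrow> (nat \<Rightarrow> 'w \<Rightarrow> 'a) \<Rightarrow> nat \<Rightarrow> ('a \<Rightarrow> real) set \<Rightarrow> 'w \<Rightarrow> ereal" where
  "sup_loglik P X n \<F> = fam_esssup P \<F> (\<lambda>f \<omega>. ereal (loglik X n f \<omega>))"

text \<open>
  The estimator is represented by the set of all maximizers, since a maximizer need neither
  exist nor be unique for every sample.
\<close>

definition order_estimator ::
  "'w measure \<Rightarrow> (nat \<Rightarrow> 'w \<Rightarrow> 'a) \<Rightarrow> (nat \<Rightarrow> ('a \<Rightarrow> real) set) \<Rightarrow>
   (nat \<Rightarrow> nat \<Rightarrow> real) \<Rightarrow> nat \<Rightarrow> 'w \<Rightarrow> nat set" where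
  "order_estimator P X \<M> pen n \<omega> =
     {q. is_arg_max (\<lambda>q. sup_loglik P X n (\<M> q) \<omega> - ereal (pen n q)) (\<lambda>q. 1 \<le> q) q}"

end

theory Submission
  imports Defs
begin

text \<open>
  Write \<open>h\<close> for the Hellinger distance to the true density. Everything rests on one uniform bound
  (\<open>likelihood_ratio_bound\<close>): there is a constant \<open>C\<close> such that, almost surely, for all large \<open>n\<close>,
  all \<open>q \<ge> q\<^sub>0\<close> and all \<open>f \<in> \<M> q\<close>, the log-likelihood ratio of \<open>f\<close> against \<open>f\<^sub>0\<close> is at most four times
  \<open>C * \<eta> q * (ln (ln n) + 1) - n * h\<^sup>2 / 8\<close>. For \<open>q > q\<^sub>0\<close> the first term is negligible against the
  penalty gap \<open>(\<eta> q - \<eta> q\<^sub>0) * w n\<close>, since this gap is at least a fixed multiple of \<open>\<eta> q * w n\<close> and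
  \<open>w n\<close> dominates \<open>ln (ln n)\<close>. For \<open>q < q\<^sub>0\<close> the densities in \<open>\<M> q\<close> keep a positive Hellinger distance
  from \<open>f\<^sub>0\<close> (\<open>hellinger_gap\<close>), so the second term is linear in \<open>n\<close> and beats the penalty, which is
  \<open>o(n)\<close>. Hence every competitor of \<open>q\<^sub>0\<close> loses.

  The bound is obtained as follows. By concavity \<open>ln u \<le> 2 * ln ((1 + u) / 2)\<close>, so the
  log-likelihood ratio, which is twice the logarithm of \<open>g = sqrt (f / f\<^sub>0)\<close>, is at most four times a
  sum of the terms \<open>mid_log (g X)\<close>. The function \<open>mid_log\<close> is bounded below, 1-Lipschitz and monotone:
  its mean is at most \<open>- h\<^sup>2 / 4\<close>, its exponential moments are controlled by the second moment of
  \<open>g - 1\<close>, and brackets of \<open>g\<close> become brackets of \<open>mid_log g\<close>.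

  For fixed \<open>N\<close> and a Hellinger ball of radius \<open>\<epsilon>\<close>, \<open>chaining_deviation\<close> shows that the sums up to
  time \<open>2 * N\<close> exceed their mean by at most \<open>N * \<epsilon>\<^sup>2 / 32\<close>, outside an event whose probability is
  exponentially small in \<open>N * \<epsilon>\<^sup>2\<close>, as soon as \<open>N * \<epsilon>\<^sup>2\<close> dominates \<open>\<eta> q\<close>. A union bound over
  brackets of a single fine scale would cost a factor \<open>ln n\<close>; the chaining keeps the entropy cost of order \<open>\<eta> q\<close>. The chain runs through the upper
  ends of the brackets, made decreasing by taking minima over the coarser scales. Its increments are
  then nonpositive, and a nonpositive variable has sub-Gaussian upper deviations governed by its
  second moment alone, which is exactly what bracketing in \<open>L\<^sup>2\<close> controls; the
  coarsest link is handled by the exponential moments of \<open>mid_log\<close>.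

  Finally, \<open>n\<close> is cut into dyadic blocks and \<open>h\<close> into dyadic shells. In the block \<open>2 ^ k \<le> n < 2 ^ (k + 1)\<close>
  the innermost radius satisfies \<open>2 ^ k * \<epsilon>\<^sup>2\<close> proportional to \<open>\<eta> q * ln k\<close>, which is of order
  \<open>\<eta> q * ln (ln n)\<close>; the failure probabilities are then summable over blocks, orders and shells, and
  the Borel-Cantelli lemma applies. In the outer shells the fluctuation is at most half of the
  drift \<open>- n * h\<^sup>2 / 4\<close>. As brackets bound functions at every point, the exceptional events are measurable
  and serve all densities at once, which is what the essential suprema require.
\<close>

section \<open>The midpoint logarithm\<close>

text \<open>
  Multiplying by \<open>1 + y + y\<^sup>2 / 2 \<le> exp y\<close> turns the right-hand side into \<open>1 + y\<^sup>4 / 4\<close>. This is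
  why a nonpositive random variable has sub-Gaussian upper deviations.
\<close>
lemma exp_minus_le_quadratic:
  fixes y :: real
  assumes "0 \<le> y"
  shows "exp (- y) \<le> 1 - y + y\<^sup>2 / 2"
proof -
  have pos: "0 < 1 - y + y\<^sup>2 / 2"
    using zero_le_power2[of "y - 1"] by (simp add: power2_diff)
  have "1 \<le> 1 + (y ^ 2)\<^sup>2 / 4"
    by simp
  also have "\<dots> = (1 - y + y\<^sup>2 / 2) * (1 + y + y\<^sup>2 / 2)"
    by (simp add: field_simps power2_eq_square)
  also have "\<dots> \<le> (1 - y + y\<^sup>2 / 2) * exp y"
    using pos exp_lower_Taylor_quadratic[OF assms] by (intro mult_left_mono) auto
  finally show ?thesis
    by (simp add: exp_minus field_simps)
qed

text \<open>
  In the power series of the remainder every exponent is at least 2, so each term gains at least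
  the factor \<open>t\<^sup>2\<close>.
\<close>
lemma exp_remainder_scale:
  fixes x t :: real
  assumes "0 \<le> x" "0 \<le> t" "t \<le> 1"
  shows "exp (t * x) - 1 - t * x \<le> t\<^sup>2 * (exp x - 1 - x)"
proof -
  have s: "summable (\<lambda>n. inverse (fact (n + 2)) *\<^sub>R (z ^ (n + 2)))" for z :: real
    using summable_exp_generic[of z] by (subst summable_iff_shift) (simp add: mult.commute)
  have "(\<Sum>n. inverse (fact (n + 2)) *\<^sub>R ((t * x) ^ (n + 2)))
      \<le> (\<Sum>n. t\<^sup>2 * (inverse (fact (n + 2)) *\<^sub>R (x ^ (n + 2))))"
  proof (intro suminf_le s summable_mult)
    fix n
    have "t ^ n * (x ^ (n + 2) * t\<^sup>2) \<le> 1 * (x ^ (n + 2) * t\<^sup>2)"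
      using assms by (intro mult_right_mono power_le_one) auto
    then show "inverse (fact (n + 2)) *\<^sub>R ((t * x) ^ (n + 2))
        \<le> t\<^sup>2 * (inverse (fact (n + 2)) *\<^sub>R (x ^ (n + 2)))"
      by (simp add: power_mult_distrib power_add power2_eq_square field_simps del: fact_Suc)
  qed
  also have "\<dots> = t\<^sup>2 * (\<Sum>n. inverse (fact (n + 2)) *\<^sub>R (x ^ (n + 2)))"
    by (intro suminf_mult s)
  finally show ?thesis
    using exp_first_two_terms[of "t * x"] exp_first_two_terms[of x] by simp
qed

text \<open>
  At \<open>u = sqrt (f x / f\<^sub>0 x)\<close> this is the logarithm of the midpoint between \<open>u\<close> and 1. Truncation at 0 makes
  it total and monotone, since bracket ends may be negative.
\<close>
definition mid_log :: "real \<Rightarrow> real" where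
  "mid_log u = ln ((1 + max 0 u) / 2)"

lemma mid_log_measurable [measurable]: "mid_log \<in> borel_measurable borel"
  unfolding mid_log_def by measurable

lemma mid_log_mono: "u \<le> v \<Longrightarrow> mid_log u \<le> mid_log v"
  unfolding mid_log_def by simp

lemma mid_log_diff_le:
  assumes "u \<le> v"
  shows "mid_log v - mid_log u \<le> v - u"
proof -
  have "mid_log v - mid_log u = ln ((1 + max 0 v) / (1 + max 0 u))"
    unfolding mid_log_def by (simp add: ln_div)
  also have "\<dots> \<le> (1 + max 0 v) / (1 + max 0 u) - 1"
    by (intro ln_le_minus_one) auto
  also have "\<dots> = (max 0 v - max 0 u) / (1 + max 0 u)"
    by (simp add: field_simps)
  also have "\<dots> \<le> (max 0 v - max 0 u) / 1"
    using assms by (intro divide_left_mono) auto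
  also have "\<dots> \<le> v - u"
    using assms by auto
  finally show ?thesis .
qed

lemma mid_log_one [simp]: "mid_log 1 = 0"
  by (simp add: mid_log_def)

lemma abs_mid_log_le: "\<bar>mid_log u\<bar> \<le> \<bar>u - 1\<bar>"
  using mid_log_diff_le[of 1 u] mid_log_diff_le[of u 1] mid_log_mono[of 1 u] mid_log_mono[of u 1]
  by (cases "u \<le> 1") auto

lemma mid_log_le_linear: "mid_log u \<le> (max 0 u - 1) / 2"
  using ln_le_minus_one[of "(1 + max 0 u) / 2"] by (simp add: mid_log_def field_simps)

text \<open>Concavity of the logarithm: the geometric mean of \<open>u\<close> and 1 is below their arithmetic mean.\<close>
lemma ln_le_mid_log:
  assumes "0 < u"
  shows "ln u \<le> 2 * mid_log u"
proof -
  have "u \<le> ((1 + u) / 2)\<^sup>2"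
    using zero_le_power2[of "u - 1"] by (simp add: field_simps power2_eq_square)
  then have "ln u \<le> ln (((1 + u) / 2)\<^sup>2)"
    using assms by simp
  also have "\<dots> = 2 * mid_log u"
    using assms by (simp add: mid_log_def ln_realpow)
  finally show ?thesis .
qed

text \<open>
  Since \<open>exp (mid_log u) - 1\<close> is half of the truncated \<open>u - 1\<close>, one second-moment condition on
  \<open>u - 1\<close> yields exponential moments of \<open>mid_log u\<close>, with the quadratic dependence on \<open>t\<close> that
  a Bernstein bound asks for.
\<close>
lemma exp_mid_log_le:
  assumes "0 \<le> t" "t \<le> 1"
  shows "exp (t * mid_log u) \<le> 1 + t * mid_log u + t\<^sup>2 * (u - 1)\<^sup>2 / 2"
proof -
  define y where "y = (max 0 u - 1) / 2"
  have y: "mid_log u = ln (1 + y)" "- 1 / 2 \<le> y"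
    by (auto simp: mid_log_def y_def field_simps)
  have yu: "\<bar>y\<bar> \<le> \<bar>u - 1\<bar> / 2"
    by (auto simp: y_def max_def)
  then have "y\<^sup>2 \<le> (\<bar>u - 1\<bar> / 2)\<^sup>2"
    by (subst abs_le_square_iff[symmetric]) auto
  then have y2: "y\<^sup>2 \<le> (u - 1)\<^sup>2 / 4"
    by (simp add: power_divide)
  have "exp (t * mid_log u) - 1 - t * mid_log u \<le> t\<^sup>2 * (2 * y\<^sup>2)"
  proof (cases "0 \<le> y")
    case True
    have "y - y\<^sup>2 \<le> ln (1 + y)"
    proof (cases "y \<le> 1")
      case True
      then show ?thesis using \<open>0 \<le> y\<close> ln_one_plus_pos_lower_bound by blast
    next
      case False
      then have "y * 1 \<le> y * y" by (intro mult_left_mono) auto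
      moreover have "0 \<le> ln (1 + y)" using False by (intro ln_ge_zero) auto
      ultimately show ?thesis unfolding power2_eq_square by linarith
    qed
    then have "exp (ln (1 + y)) - 1 - ln (1 + y) \<le> 2 * y\<^sup>2"
    proof -
      have "exp (ln (1 + y)) = 1 + y" using True by simp
      then show ?thesis using \<open>y - y\<^sup>2 \<le> ln (1 + y)\<close> zero_le_power2[of y] by linarith
    qed
    moreover have "exp (t * ln (1 + y)) - 1 - t * ln (1 + y)
        \<le> t\<^sup>2 * (exp (ln (1 + y)) - 1 - ln (1 + y))"
      using True assms by (intro exp_remainder_scale) auto
    ultimately show ?thesis
      unfolding y(1) by (meson mult_left_mono order_trans zero_le_power2)
  next
    case False
    define z where "z = - ln (1 + y)"
    have z0: "0 \<le> z" using False y(2) by (simp add: z_def)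
    have "z = ln (1 / (1 + y))" using y(2) by (simp add: z_def ln_div)
    also have "\<dots> \<le> 1 / (1 + y) - 1" using y(2) by (intro ln_le_minus_one) auto
    also have "\<dots> = - y / (1 + y)" using y(2) by (simp add: field_simps)
    also have "\<dots> \<le> - y / (1 / 2)" using False y(2) by (intro divide_left_mono) auto
    finally have "z \<le> 2 * (- y)" by simp
    then have "z\<^sup>2 \<le> (2 * (- y))\<^sup>2" using z0 by (intro power_mono) auto
    then have "(t * z)\<^sup>2 / 2 \<le> t\<^sup>2 * (2 * y\<^sup>2)"
      by (simp add: power_mult_distrib) (metis mult.left_commute mult_left_mono zero_le_power2)
    then show ?thesis
      using exp_minus_le_quadratic[of "t * z"] mult_nonneg_nonneg[OF assms(1) z0]
      unfolding y(1) z_def by simp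
  qed
  also have "\<dots> \<le> t\<^sup>2 * (u - 1)\<^sup>2 / 2"
    using mult_left_mono[OF y2, of "t\<^sup>2"] by simp
  finally show ?thesis by simp
qed

section \<open>A maximal inequality for partial sums\<close>

lemma (in prob_space) indep_var_nn_integral_mult:
  fixes A B :: "'a \<Rightarrow> ennreal"
  assumes "indep_var borel A borel B"
  shows "(\<integral>\<^sup>+\<omega>. A \<omega> * B \<omega> \<partial>M) = (\<integral>\<^sup>+\<omega>. A \<omega> \<partial>M) * (\<integral>\<^sup>+\<omega>. B \<omega> \<partial>M)"
proof -
  have "indep_vars (\<lambda>_. borel) (case_bool A B) UNIV"
    using assms unfolding indep_var_def by (simp add: case_bool_if if_distrib cong: if_cong)
  from indep_vars_nn_integral[OF _ this]
  show ?thesis by (simp add: UNIV_bool mult.commute)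
qed

text \<open>
  Doob's maximal inequality for the supermartingale \<open>exp (S n)\<close>, by first passage. The mass
  \<open>exp a\<close> times the probability of having reached level \<open>a\<close>, plus the expectation of \<open>exp (S n)\<close> on the
  paths still below \<open>a\<close>, does not increase with \<open>n\<close>: one more independent factor of mean at most 1
  does not increase the second part, and the paths that cross contribute at least \<open>exp a\<close>
  each.
\<close>
lemma (in prob_space) exp_maximal_inequality:
  fixes Z :: "nat \<Rightarrow> 'a \<Rightarrow> real"
  assumes indep: "indep_vars (\<lambda>_. borel) Z {1..}"
    and mgf: "\<And>i. 1 \<le> i \<Longrightarrow> (\<integral>\<^sup>+\<omega>. ennreal (exp (Z i \<omega>)) \<partial>M) \<le> 1"
  shows "prob {\<omega>\<in>space M. \<exists>n\<in>{1..m}. a \<le> (\<Sum>i=1..n. Z i \<omega>)} \<le> exp (- a)"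
proof -
  have Z [measurable]: "Z i \<in> borel_measurable M" if "1 \<le> i" for i
    using indep that by (auto simp: indep_vars_def2)
  define S where "S n \<omega> = (\<Sum>i=1..n. Z i \<omega>)" for n \<omega>
  have S [measurable]: "S n \<in> borel_measurable M" for n
    unfolding S_def by measurable
  define E where "E n = {\<omega>\<in>space M. \<forall>k\<in>{1..n}. S k \<omega> < a}" for n
  define F where "F n = {\<omega>\<in>space M. \<exists>k\<in>{1..n}. a \<le> S k \<omega>}" for n
  have E [measurable]: "E n \<in> sets M" and F [measurable]: "F n \<in> sets M" for n
    unfolding E_def F_def by measurable
  define T where "T n = (\<integral>\<^sup>+\<omega>. ennreal (exp (S n \<omega>)) * indicator (E n) \<omega> \<partial>M)" for n
  \<comment> \<open>\<open>F n\<close> collects the paths that have reached \<open>a\<close>; \<open>T n\<close> is the weight of those still in \<open>E n\<close>.\<close>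
  have "ennreal (exp a) * emeasure M (F n) + T n \<le> 1" for n
  proof (induction n)
    case 0
    then show ?case by (simp add: T_def F_def E_def S_def emeasure_space_1)
  next
    case (Suc n)
    define G where "G = E n \<inter> {\<omega>\<in>space M. a \<le> S (Suc n) \<omega>}"
    have G [measurable]: "G \<in> sets M" unfolding G_def by measurable
    have 1: "F (Suc n) = F n \<union> G" "F n \<inter> G = {}"
      by (auto simp: F_def G_def E_def atLeastAtMostSuc_conv not_le)
    have 2: "indicator (E n) \<omega> = (indicator G \<omega> + indicator (E (Suc n)) \<omega> :: ennreal)"
      if "\<omega> \<in> space M" for \<omega>
      using that by (auto simp: indicator_def G_def E_def atLeastAtMostSuc_conv not_le)
    have "indep_var borel ((\<lambda>f. ennreal (exp (\<Sum>i=1..n. f i)) *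
              indicator {f. \<forall>k\<in>{1..n}. (\<Sum>i=1..k. f i) < a} f) \<circ>
              (\<lambda>\<omega>. restrict (\<lambda>i. Z i \<omega>) {1..n}))
            borel ((\<lambda>f. ennreal (exp (f (Suc n)))) \<circ> (\<lambda>\<omega>. restrict (\<lambda>i. Z i \<omega>) {Suc n}))"
    proof (rule indep_var_compose[OF indep_var_restrict[OF indep]])
      have "{f \<in> space (Pi\<^sub>M {1..n} (\<lambda>_. borel)). \<forall>k\<in>{1..n}. (\<Sum>i=1..k. f i) < a}
          \<in> sets (Pi\<^sub>M {1..n} (\<lambda>_. borel :: real measure))"
        by measurable
      then have "(\<lambda>f. indicator {f. \<forall>k\<in>{1..n}. (\<Sum>i=1..k. f i) < a} f :: ennreal)
          \<in> borel_measurable (Pi\<^sub>M {1..n} (\<lambda>_. borel :: real measure))"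
        by (subst borel_measurable_indicator_iff) (simp add: Int_def conj_commute)
      then show "(\<lambda>f. ennreal (exp (\<Sum>i=1..n. f i)) *
              indicator {f. \<forall>k\<in>{1..n}. (\<Sum>i=1..k. f i) < a} f)
          \<in> borel_measurable (Pi\<^sub>M {1..n} (\<lambda>_. borel :: real measure))"
        by (intro borel_measurable_times_ennreal) measurable
    qed auto
    also have "(\<lambda>f. ennreal (exp (\<Sum>i=1..n. f i)) *
              indicator {f. \<forall>k\<in>{1..n}. (\<Sum>i=1..k. f i) < a} f) \<circ>
              (\<lambda>\<omega>. restrict (\<lambda>i. Z i \<omega>) {1..n})
          = (\<lambda>\<omega>. ennreal (exp (S n \<omega>)) * indicator {\<omega>. \<forall>k\<in>{1..n}. S k \<omega> < a} \<omega>)"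
      by (rule ext) (auto simp: S_def indicator_def)
    also have "(\<lambda>f. ennreal (exp (f (Suc n)))) \<circ> (\<lambda>\<omega>. restrict (\<lambda>i. Z i \<omega>) {Suc n})
        = (\<lambda>\<omega>. ennreal (exp (Z (Suc n) \<omega>)))"
      by auto
    finally have "(\<integral>\<^sup>+\<omega>. ennreal (exp (S n \<omega>)) * indicator {\<omega>. \<forall>k\<in>{1..n}. S k \<omega> < a} \<omega> *
            ennreal (exp (Z (Suc n) \<omega>)) \<partial>M)
        = (\<integral>\<^sup>+\<omega>. ennreal (exp (S n \<omega>)) * indicator {\<omega>. \<forall>k\<in>{1..n}. S k \<omega> < a} \<omega> \<partial>M) *
          (\<integral>\<^sup>+\<omega>. ennreal (exp (Z (Suc n) \<omega>)) \<partial>M)"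
      by (rule indep_var_nn_integral_mult)
    also have "(\<integral>\<^sup>+\<omega>. ennreal (exp (S n \<omega>)) * indicator {\<omega>. \<forall>k\<in>{1..n}. S k \<omega> < a} \<omega> \<partial>M)
        = T n"
      unfolding T_def by (intro nn_integral_cong) (auto simp: E_def indicator_def)
    also have "T n * (\<integral>\<^sup>+\<omega>. ennreal (exp (Z (Suc n) \<omega>)) \<partial>M) \<le> T n * 1"
      by (intro mult_left_mono mgf) auto
    also have "(\<integral>\<^sup>+\<omega>. ennreal (exp (S n \<omega>)) * indicator {\<omega>. \<forall>k\<in>{1..n}. S k \<omega> < a} \<omega> *
            ennreal (exp (Z (Suc n) \<omega>)) \<partial>M)
        = (\<integral>\<^sup>+\<omega>. ennreal (exp (S (Suc n) \<omega>)) * indicator G \<omega> +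
                 ennreal (exp (S (Suc n) \<omega>)) * indicator (E (Suc n)) \<omega> \<partial>M)"
    proof (intro nn_integral_cong)
      fix \<omega> assume \<omega>: "\<omega> \<in> space M"
      have "ennreal (exp (S n \<omega>)) * indicator {\<omega>. \<forall>k\<in>{1..n}. S k \<omega> < a} \<omega> *
            ennreal (exp (Z (Suc n) \<omega>))
          = ennreal (exp (S (Suc n) \<omega>)) * indicator (E n) \<omega>"
        using \<omega> by (auto simp: E_def indicator_def S_def exp_add ennreal_mult)
      then show "ennreal (exp (S n \<omega>)) * indicator {\<omega>. \<forall>k\<in>{1..n}. S k \<omega> < a} \<omega> *
            ennreal (exp (Z (Suc n) \<omega>)) = ennreal (exp (S (Suc n) \<omega>)) * indicator G \<omega> +
                 ennreal (exp (S (Suc n) \<omega>)) * indicator (E (Suc n)) \<omega>"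
        by (simp add: 2[OF \<omega>] distrib_left)
    qed
    also have "\<dots> = (\<integral>\<^sup>+\<omega>. ennreal (exp (S (Suc n) \<omega>)) * indicator G \<omega> \<partial>M) + T (Suc n)"
      unfolding T_def by (intro nn_integral_add) measurable
    finally have 3: "(\<integral>\<^sup>+\<omega>. ennreal (exp (S (Suc n) \<omega>)) * indicator G \<omega> \<partial>M) + T (Suc n) \<le> T n"
      by simp
    have "ennreal (exp a) * emeasure M G = (\<integral>\<^sup>+\<omega>. ennreal (exp a) * indicator G \<omega> \<partial>M)"
      by (rule nn_integral_cmult_indicator[symmetric]) measurable
    also have "\<dots> \<le> (\<integral>\<^sup>+\<omega>. ennreal (exp (S (Suc n) \<omega>)) * indicator G \<omega> \<partial>M)"
      by (intro nn_integral_mono) (auto simp: indicator_def G_def)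
    finally have 4: "ennreal (exp a) * emeasure M G + T (Suc n) \<le> T n"
      using 3 by (meson add_right_mono order_trans)
    have "ennreal (exp a) * emeasure M (F (Suc n)) + T (Suc n)
        = ennreal (exp a) * emeasure M (F n) + (ennreal (exp a) * emeasure M G + T (Suc n))"
      using 1 by (simp add: plus_emeasure[symmetric] distrib_left add.assoc)
    also have "\<dots> \<le> ennreal (exp a) * emeasure M (F n) + T n"
      by (intro add_left_mono 4)
    finally show ?case using Suc.IH by simp
  qed
  then have "ennreal (exp a) * emeasure M (F m) \<le> 1"
    by (meson add_increasing2 order_trans zero_le order_refl add_mono le_add_same_cancel1)
  then have "exp a * prob (F m) \<le> 1"
    by (simp add: emeasure_eq_measure ennreal_mult[symmetric])
  then have "prob (F m) \<le> exp (- a)"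
    by (simp add: exp_minus field_simps)
  then show ?thesis by (simp add: F_def S_def)
qed

text \<open>A quadratic majorant of the exponential, integrated and absorbed through \<open>1 + z \<le> exp z\<close>.\<close>
lemma (in prob_space) nn_integral_exp_centered_le:
  fixes D V :: "'a \<Rightarrow> real"
  assumes D: "integrable M D" and V: "integrable M V" "expectation V \<le> v"
    and le: "\<And>x. x \<in> space M \<Longrightarrow> exp (t * D x) \<le> 1 + t * D x + t\<^sup>2 * V x / 2"
  shows "(\<integral>\<^sup>+x. ennreal (exp (t * (D x - expectation D) - t\<^sup>2 * v / 2)) \<partial>M) \<le> 1"
proof -
  let ?c = "exp (- (t * expectation D) - t\<^sup>2 * v / 2)"
  have int: "integrable M (\<lambda>x. ?c * (1 + t * D x + t\<^sup>2 * V x / 2))"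
    using D V by auto
  have "(\<integral>\<^sup>+x. ennreal (exp (t * (D x - expectation D) - t\<^sup>2 * v / 2)) \<partial>M)
      = (\<integral>\<^sup>+x. ennreal (?c * exp (t * D x)) \<partial>M)"
    by (simp add: mult_exp_exp algebra_simps)
  also have "\<dots> \<le> (\<integral>\<^sup>+x. ennreal (?c * (1 + t * D x + t\<^sup>2 * V x / 2)) \<partial>M)"
    by (intro nn_integral_mono ennreal_leI mult_left_mono le) auto
  also have "\<dots> = ennreal (expectation (\<lambda>x. ?c * (1 + t * D x + t\<^sup>2 * V x / 2)))"
  proof (intro nn_integral_eq_integral[OF int] AE_I2)
    fix x assume "x \<in> space M"
    then have "0 \<le> 1 + t * D x + t\<^sup>2 * V x / 2"
      using le[of x] exp_ge_zero[of "t * D x"] by linarith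
    then show "0 \<le> ?c * (1 + t * D x + t\<^sup>2 * V x / 2)" by simp
  qed
  also have "\<dots> \<le> ennreal 1"
  proof (rule ennreal_leI)
    have "expectation (\<lambda>x. ?c * (1 + t * D x + t\<^sup>2 * V x / 2))
        = ?c * (1 + t * expectation D + t\<^sup>2 * expectation V / 2)"
      using D V by (simp add: prob_space)
    also have "\<dots> \<le> ?c * (1 + (t * expectation D + t\<^sup>2 * v / 2))"
      using mult_left_mono[OF V(2), of "t\<^sup>2"] by (intro mult_left_mono) auto
    also have "\<dots> \<le> ?c * exp (t * expectation D + t\<^sup>2 * v / 2)"
      by (intro mult_left_mono exp_ge_add_one_self) auto
    also have "\<dots> = 1"
      by (simp add: mult_exp_exp)
    finally show "expectation (\<lambda>x. ?c * (1 + t * D x + t\<^sup>2 * V x / 2)) \<le> 1" .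
  qed
  finally show ?thesis by simp
qed

text \<open>The law \<open>\<nu>\<close> is a parameter so that the chaining argument does not depend on densities.\<close>
locale iid_sample = prob_space P for P :: "'w measure" +
  fixes \<mu> \<nu> :: "'a measure" and X :: "nat \<Rightarrow> 'w \<Rightarrow> 'a"
  assumes indep: "indep_vars (\<lambda>_. \<mu>) X {1..}"
    and law: "\<And>k. 1 \<le> k \<Longrightarrow> distr P \<mu> (X k) = \<nu>"
begin

lemma X_measurable [measurable]: "1 \<le> k \<Longrightarrow> X k \<in> measurable P \<mu>"
  using indep by (auto simp: indep_vars_def2)

lemma sets_law [measurable_cong, simp]: "sets \<nu> = sets \<mu>"
  using law[of 1] by (auto dest: arg_cong[of _ _ sets])

lemma space_law [simp]: "space \<nu> = space \<mu>"
  by (rule sets_eq_imp_space_eq) simp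

lemma prob_space_law: "prob_space \<nu>"
  using prob_space_distr[OF X_measurable[of 1]] law[of 1] by simp

lemma X_space: "1 \<le> k \<Longrightarrow> \<omega> \<in> space P \<Longrightarrow> X k \<omega> \<in> space \<mu>"
  by (rule measurable_space[OF X_measurable])

lemma AE_law:
  assumes "1 \<le> k" "AE x in \<nu>. Q x"
  shows "AE \<omega> in P. Q (X k \<omega>)"
  using assms law[of k] by (intro AE_distrD[OF X_measurable]) auto

text \<open>
  Chernoff bound that is uniform over the whole time horizon. The majorant hypothesis covers both
  uses: \<open>V = D\<^sup>2\<close> for nonpositive \<open>D\<close>, and \<open>V = (u - 1)\<^sup>2\<close> for \<open>D = mid_log u\<close>.
\<close>
lemma partial_sum_deviation:
  fixes D V :: "'a \<Rightarrow> real"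
  assumes D: "integrable \<nu> D" and V: "integrable \<nu> V" "integral\<^sup>L \<nu> V \<le> v" "0 \<le> v" and t: "0 \<le> t"
    and le: "\<And>x. x \<in> space \<nu> \<Longrightarrow> exp (t * D x) \<le> 1 + t * D x + t\<^sup>2 * V x / 2"
  shows "prob {\<omega>\<in>space P. \<exists>n\<in>{1..m}. b < (\<Sum>i=1..n. D (X i \<omega>) - integral\<^sup>L \<nu> D)}
    \<le> exp (- (t * b) + m * (t\<^sup>2 * v / 2))"
proof -
  interpret \<nu>: prob_space \<nu> by (rule prob_space_law)
  define Z where "Z x = t * (D x - integral\<^sup>L \<nu> D) - t\<^sup>2 * v / 2" for x
  have Dm [measurable]: "D \<in> borel_measurable \<mu>"
    using borel_measurable_integrable[OF D] by (simp cong: measurable_cong_sets)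
  have Zm [measurable]: "Z \<in> borel_measurable \<mu>"
    unfolding Z_def by measurable
  have "indep_vars (\<lambda>_. borel) (\<lambda>i \<omega>. Z (X i \<omega>)) {1..}"
    using indep_vars_compose2[OF indep, of "\<lambda>_. Z" "\<lambda>_. borel"] by simp
  moreover have "(\<integral>\<^sup>+\<omega>. ennreal (exp (Z (X i \<omega>))) \<partial>P) \<le> 1" if "1 \<le> i" for i
  proof -
    have "(\<integral>\<^sup>+\<omega>. ennreal (exp (Z (X i \<omega>))) \<partial>P) = (\<integral>\<^sup>+x. ennreal (exp (Z x)) \<partial>distr P \<mu> (X i))"
      using that by (subst nn_integral_distr) auto
    also have "\<dots> \<le> 1"
      unfolding law[OF that] Z_def by (rule \<nu>.nn_integral_exp_centered_le[OF D V(1,2) le])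
    finally show ?thesis .
  qed
  ultimately have *: "prob {\<omega>\<in>space P. \<exists>n\<in>{1..m}. t * b - m * (t\<^sup>2 * v / 2) \<le> (\<Sum>i=1..n. Z (X i \<omega>))}
      \<le> exp (- (t * b - m * (t\<^sup>2 * v / 2)))"
    by (rule exp_maximal_inequality)
  have "t * b - m * (t\<^sup>2 * v / 2) \<le> (\<Sum>i=1..n. Z (X i \<omega>))"
    if "n \<in> {1..m}" "b < (\<Sum>i=1..n. D (X i \<omega>) - integral\<^sup>L \<nu> D)" for n \<omega>
  proof -
    have "real n * (t\<^sup>2 * v / 2) \<le> real m * (t\<^sup>2 * v / 2)"
      using that V(3) by (intro mult_right_mono) auto
    moreover have "t * b \<le> t * (\<Sum>i=1..n. D (X i \<omega>) - integral\<^sup>L \<nu> D)"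
      using that t by (intro mult_left_mono) auto
    moreover have "(\<Sum>i=1..n. Z (X i \<omega>))
        = t * (\<Sum>i=1..n. D (X i \<omega>) - integral\<^sup>L \<nu> D) - real n * (t\<^sup>2 * v / 2)"
      by (simp add: Z_def sum_subtractf sum_distrib_left[symmetric])
    ultimately show ?thesis by linarith
  qed
  then have "prob {\<omega>\<in>space P. \<exists>n\<in>{1..m}. b < (\<Sum>i=1..n. D (X i \<omega>) - integral\<^sup>L \<nu> D)}
      \<le> prob {\<omega>\<in>space P. \<exists>n\<in>{1..m}. t * b - m * (t\<^sup>2 * v / 2) \<le> (\<Sum>i=1..n. Z (X i \<omega>))}"
    by (intro finite_measure_mono) (blast, measurable)
  also note *
  finally show ?thesis by simp
qed

end

section \<open>Chaining along upper brackets\<close>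

lemma integrable_square_add:
  fixes f g :: "'a \<Rightarrow> real"
  assumes [measurable]: "f \<in> borel_measurable M" "g \<in> borel_measurable M"
    and int: "integrable M (\<lambda>x. (f x)\<^sup>2)" "integrable M (\<lambda>x. (g x)\<^sup>2)"
  shows "integrable M (\<lambda>x. (f x + g x)\<^sup>2)"
    and "(\<integral>x. (f x + g x)\<^sup>2 \<partial>M) \<le> 2 * (\<integral>x. (f x)\<^sup>2 \<partial>M) + 2 * (\<integral>x. (g x)\<^sup>2 \<partial>M)"
proof -
  have le: "(f x + g x)\<^sup>2 \<le> 2 * (f x)\<^sup>2 + 2 * (g x)\<^sup>2" for x
    using zero_le_power2[of "f x - g x"] by (simp add: power2_sum power2_diff)
  show *: "integrable M (\<lambda>x. (f x + g x)\<^sup>2)"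
    by (rule Bochner_Integration.integrable_bound[where f="\<lambda>x. 2 * (f x)\<^sup>2 + 2 * (g x)\<^sup>2"])
      (use int le in auto)
  have "(\<integral>x. (f x + g x)\<^sup>2 \<partial>M) \<le> (\<integral>x. 2 * (f x)\<^sup>2 + 2 * (g x)\<^sup>2 \<partial>M)"
    by (intro integral_mono * le) (use int in auto)
  then show "(\<integral>x. (f x + g x)\<^sup>2 \<partial>M) \<le> 2 * (\<integral>x. (f x)\<^sup>2 \<partial>M) + 2 * (\<integral>x. (g x)\<^sup>2 \<partial>M)"
    using int by simp
qed

lemma (in prob_space) integral_le_L2:
  fixes f :: "'a \<Rightarrow> real"
  assumes [measurable]: "f \<in> borel_measurable M"
    and int: "integrable M (\<lambda>x. (f x)\<^sup>2)" and le: "expectation (\<lambda>x. (f x)\<^sup>2) \<le> d\<^sup>2" and d: "0 \<le> d"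
  shows "expectation f \<le> d"
proof -
  have "0 \<le> expectation (\<lambda>x. (f x)\<^sup>2) - (expectation f)\<^sup>2"
    using variance_positive[of f] variance_eq[OF square_integrable_imp_integrable[OF _ int] int]
    by simp
  then have "(expectation f)\<^sup>2 \<le> d\<^sup>2" using le by linarith
  then show ?thesis using d by (rule power2_le_imp_le)
qed

lemma (in prob_space) prob_UN_le_sums:
  fixes A :: "nat \<Rightarrow> 'a set"
  assumes A: "\<And>i. A i \<in> sets M" and le: "\<And>i. prob (A i) \<le> b i" and b: "b sums c"
  shows "prob (\<Union>i. A i) \<le> c"
proof -
  have s: "summable (\<lambda>i. prob (A i))"
    by (rule summable_comparison_test'[OF sums_summable[OF b], of 0]) (simp add: le)
  have "prob (\<Union>i. A i) \<le> (\<Sum>i. prob (A i))"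
    using A s by (intro finite_measure_subadditive_countably) auto
  also have "\<dots> \<le> (\<Sum>i. b i)"
    by (intro suminf_le le s sums_summable[OF b])
  finally show ?thesis using sums_unique[OF b] by simp
qed

lemma square_Suc_le_powr:
  "(real s + 1)\<^sup>2 \<le> 4 * (9 / 4) ^ s"
proof (induction s)
  case (Suc s)
  show ?case
  proof (cases "s = 0")
    case False
    then have "(real (Suc s) + 1)\<^sup>2 \<le> ((3 / 2) * (real s + 1))\<^sup>2"
      by (intro power_mono) auto
    also have "\<dots> = (9 / 4) * (real s + 1)\<^sup>2"
      by (simp add: power2_eq_square algebra_simps)
    also have "\<dots> \<le> 4 * (9 / 4) ^ Suc s"
      using Suc by simp
    finally show ?thesis .
  qed auto
qed auto

lemma (in prob_space) integrable_mid_log: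
  assumes [measurable]: "u \<in> borel_measurable M" and "integrable M (\<lambda>x. (u x - 1)\<^sup>2)"
  shows "integrable M (\<lambda>x. mid_log (u x))"
proof -
  have "integrable M (\<lambda>x. u x - 1)"
    by (rule square_integrable_imp_integrable) (use assms in auto)
  then show ?thesis
    by (rule Bochner_Integration.integrable_bound) (auto simp: abs_mid_log_le)
qed

text \<open>
  At scale \<open>s\<close> the class is bracketed with width \<open>\<epsilon> / 2 ^ s\<close>. The path of \<open>g\<close> through the scales is
  given by the minimum of its upper bracket ends so far, and \<open>mid_log g\<close> is at most the sum of
  the increments along this path. An increment at scale \<open>s\<close> has second moment of order
  \<open>\<epsilon>\<^sup>2 / 4 ^ s\<close>, while there are at most \<open>exp (e * (s + 1) * (ln K + s))\<close> of them. So deviations decreasing like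
  \<open>(3 / 4) ^ s\<close> have exponents growing like \<open>(9 / 4) ^ s\<close>, which beats the polynomial
  growth of the entropy.
\<close>
lemma (in iid_sample) chaining_deviation:
  fixes H :: "('a \<Rightarrow> real) set" and K e \<epsilon> x :: real and N :: nat
  assumes K: "1 \<le> K" and e: "0 \<le> e" and \<epsilon>: "0 < \<epsilon>"
    and meas: "\<And>g. g \<in> H \<Longrightarrow> g \<in> borel_measurable \<mu>"
    and int: "\<And>g. g \<in> H \<Longrightarrow> integrable \<nu> (\<lambda>x. (g x - 1)\<^sup>2)"
    and L2: "\<And>g. g \<in> H \<Longrightarrow> (\<integral>x. (g x - 1)\<^sup>2 \<partial>\<nu>) \<le> \<epsilon>\<^sup>2"
    and cover: "\<And>\<delta>. 0 < \<delta> \<Longrightarrow> \<delta> \<le> \<epsilon> \<Longrightarrow> \<exists>n. bracket_cover \<nu> H \<delta> n \<and> real n \<le> (K * \<epsilon> / \<delta>) powr e"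
    and x_def: "x = real N * \<epsilon>\<^sup>2 / 819200"
    and large: "4 * e * (1 + ln K) \<le> x" "1 \<le> x"
  shows "\<exists>B\<in>sets P. prob B \<le> 2 * exp (- x) \<and>
    (\<forall>\<omega>\<in>space P - B. \<forall>n\<in>{1..2*N}. \<forall>g\<in>H.
       (\<Sum>i=1..n. mid_log (g (X i \<omega>))) \<le> n * (\<integral>x. mid_log (g x) \<partial>\<nu>) + N * \<epsilon>\<^sup>2 / 32)"
proof -
  interpret \<nu>: prob_space \<nu> by (rule prob_space_law)
  define R where "R = real N * \<epsilon>\<^sup>2"
  have R0: "0 \<le> R" by (simp add: R_def)
  have xR: "R = 819200 * x" by (simp add: x_def R_def)
  \<comment> \<open>All deviations together amount to \<open>4 * \<alpha> * R = R / 40\<close>, below the allowance \<open>R / 32\<close>; and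
    \<open>x = R * \<alpha>\<^sup>2 / 32\<close> explains the number 819200.\<close>
  define \<alpha> :: real where "\<alpha> = 1 / 160"
  define \<delta> where "\<delta> s = \<epsilon> / 2 ^ s" for s :: nat
  have \<delta>: "0 < \<delta> s" "\<delta> s \<le> \<epsilon>" for s
    using \<epsilon> by (auto simp: \<delta>_def field_simps mult_le_cancel_right1)
  have "\<exists>n. bracket_cover \<nu> H (\<delta> s) n \<and> real n \<le> (K * 2 ^ s) powr e" for s
    using cover[OF \<delta>(1) \<delta>(2), of s] \<epsilon> by (simp add: \<delta>_def)
  then obtain card_at where bc: "\<And>s. bracket_cover \<nu> H (\<delta> s) (card_at s)"
    and card_at: "\<And>s. real (card_at s) \<le> (K * 2 ^ s) powr e"
    by metis
  define covers where "covers s L U \<longleftrightarrow>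
      (\<forall>i<card_at s. L i \<in> borel_measurable \<nu> \<and> U i \<in> borel_measurable \<nu> \<and>
         integrable \<nu> (\<lambda>x. (U i x - L i x)\<^sup>2) \<and> L2_norm \<nu> (\<lambda>x. U i x - L i x) \<le> \<delta> s) \<and>
      (\<forall>g\<in>H. \<exists>i<card_at s. \<forall>x\<in>space \<nu>. L i x \<le> g x \<and> g x \<le> U i x)"
    for s and L U :: "nat \<Rightarrow> 'a \<Rightarrow> real"
  have "\<exists>L U. covers s L U" for s
    using bc[of s] unfolding bracket_cover_def covers_def .
  then obtain gL gU where gLU: "\<And>s. covers s (gL s) (gU s)"
    by metis
  have br: "gL s i \<in> borel_measurable \<nu> \<and> gU s i \<in> borel_measurable \<nu> \<and>
         integrable \<nu> (\<lambda>x. (gU s i x - gL s i x)\<^sup>2) \<and>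
         L2_norm \<nu> (\<lambda>x. gU s i x - gL s i x) \<le> \<delta> s" if "i < card_at s" for s i
    using gLU[of s] that unfolding covers_def by blast
  define in_bracket where "in_bracket g s i \<longleftrightarrow> i < card_at s \<and>
      (\<forall>x\<in>space \<mu>. gL s i x \<le> g x \<and> g x \<le> gU s i x)" for g s i
  have "\<exists>i. in_bracket g s i" if "g \<in> H" for g s
    using gLU[of s] that unfolding covers_def in_bracket_def space_law by blast
  then obtain c where "\<And>g s. g \<in> H \<Longrightarrow> in_bracket g s (c g s)"
    by metis
  then have c: "\<And>s g. g \<in> H \<Longrightarrow> c g s < card_at s"
    and c_br: "\<And>s g x. g \<in> H \<Longrightarrow> x \<in> space \<mu> \<Longrightarrow> gL s (c g s) x \<le> g x \<and> g x \<le> gU s (c g s) x"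
    unfolding in_bracket_def by blast+
  have gm [measurable]: "gL s i \<in> borel_measurable \<mu>" "gU s i \<in> borel_measurable \<mu>"
    if "i < card_at s" for s i
    using br[OF that] by (simp_all cong: measurable_cong_sets)
  have width: "(\<integral>x. (gU s i x - gL s i x)\<^sup>2 \<partial>\<nu>) \<le> (\<delta> s)\<^sup>2" if "i < card_at s" for s i
  proof -
    have "sqrt (\<integral>x. (gU s i x - gL s i x)\<^sup>2 \<partial>\<nu>) \<le> \<delta> s"
      using br[OF that] by (simp add: L2_norm_def)
    then show ?thesis by (rule sqrt_le_D)
  qed
  define U where "U s \<kappa> x = Min ((\<lambda>r. gU r (\<kappa> r) x) ` {..s})" for s :: nat and \<kappa> and x
  have U_le: "U s \<kappa> x \<le> gU s (\<kappa> s) x" for s \<kappa> x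
    unfolding U_def by (intro Min_le) auto
  have U_anti: "U (Suc s) \<kappa> x \<le> U s \<kappa> x" for s \<kappa> x
    unfolding U_def by (intro Min_antimono) auto
  have U_ge: "g x \<le> U s (c g) x" if "g \<in> H" "x \<in> space \<mu>" for s g x
    unfolding U_def using c_br[OF that] by (subst Min_ge_iff) auto
  have Um [measurable]: "U s (c g) \<in> borel_measurable \<mu>" if "g \<in> H" for s g
    unfolding U_def[abs_def] using c[OF that] by (intro borel_measurable_Min) auto
  define Z where "Z s \<kappa> = (\<lambda>x. case s of 0 \<Rightarrow> mid_log (U 0 \<kappa> x)
      | Suc r \<Rightarrow> mid_log (U (Suc r) \<kappa> x) - mid_log (U r \<kappa> x))" for s :: nat and \<kappa>
  have Z_sum: "(\<Sum>s\<le>S. Z s \<kappa> x) = mid_log (U S \<kappa> x)" for S \<kappa> x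
    by (induction S) (auto simp: Z_def)
  have gap_int: "integrable \<nu> (\<lambda>x. (U s (c g) x - g x)\<^sup>2)"
    and gap_le: "(\<integral>x. (U s (c g) x - g x)\<^sup>2 \<partial>\<nu>) \<le> (\<delta> s)\<^sup>2" if g: "g \<in> H" for s g
  proof -
    note [measurable] = meas[OF g] Um[OF g]
    have le: "(U s (c g) x - g x)\<^sup>2 \<le> (gU s (c g s) x - gL s (c g s) x)\<^sup>2" if "x \<in> space \<mu>" for x
      using U_ge[OF g that, of s] U_le[of s "c g" x] c_br[OF g that, of s]
      by (intro power_mono) auto
    have i: "integrable \<nu> (\<lambda>x. (gU s (c g s) x - gL s (c g s) x)\<^sup>2)"
      using br[OF c[OF g]] by blast
    show i2: "integrable \<nu> (\<lambda>x. (U s (c g) x - g x)\<^sup>2)"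
      by (rule Bochner_Integration.integrable_bound[OF i]) (use le in auto)
    have "(\<integral>x. (U s (c g) x - g x)\<^sup>2 \<partial>\<nu>) \<le> (\<integral>x. (gU s (c g s) x - gL s (c g s) x)\<^sup>2 \<partial>\<nu>)"
      by (intro integral_mono i i2) (use le in auto)
    then show "(\<integral>x. (U s (c g) x - g x)\<^sup>2 \<partial>\<nu>) \<le> (\<delta> s)\<^sup>2"
      using width[OF c[OF g], of s] by linarith
  qed
  have U1_int: "integrable \<nu> (\<lambda>x. (U s (c g) x - 1)\<^sup>2)"
    and U1_le: "(\<integral>x. (U s (c g) x - 1)\<^sup>2 \<partial>\<nu>) \<le> 2 * (\<delta> s)\<^sup>2 + 2 * \<epsilon>\<^sup>2" if g: "g \<in> H" for s g
  proof -
    note [measurable] = meas[OF g] Um[OF g]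
    have eq: "(\<lambda>x. (U s (c g) x - 1)\<^sup>2) = (\<lambda>x. ((U s (c g) x - g x) + (g x - 1))\<^sup>2)"
      by simp
    show "integrable \<nu> (\<lambda>x. (U s (c g) x - 1)\<^sup>2)"
      unfolding eq by (intro integrable_square_add gap_int int g) measurable
    have "(\<integral>x. (U s (c g) x - 1)\<^sup>2 \<partial>\<nu>)
        \<le> 2 * (\<integral>x. (U s (c g) x - g x)\<^sup>2 \<partial>\<nu>) + 2 * (\<integral>x. (g x - 1)\<^sup>2 \<partial>\<nu>)"
      unfolding eq by (intro integrable_square_add gap_int int g) measurable
    then show "(\<integral>x. (U s (c g) x - 1)\<^sup>2 \<partial>\<nu>) \<le> 2 * (\<delta> s)\<^sup>2 + 2 * \<epsilon>\<^sup>2"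
      using gap_le[OF g, of s] L2[OF g] by linarith
  qed
  have mlU: "integrable \<nu> (\<lambda>x. mid_log (U s (c g) x))" if g: "g \<in> H" for s g
    using U1_int[OF g] Um[OF g] by (intro \<nu>.integrable_mid_log) simp_all
  have mlg: "integrable \<nu> (\<lambda>x. mid_log (g x))" if g: "g \<in> H" for g
    using int[OF g] meas[OF g] by (intro \<nu>.integrable_mid_log) simp_all
  have Z_int: "integrable \<nu> (Z s (c g))" if g: "g \<in> H" for s g
    using mlU[OF g] by (cases s) (auto simp: Z_def[abs_def])
  \<comment> \<open>\<open>a s\<close> is the deviation allowed at scale \<open>s\<close> and \<open>t s = a s / (8 * N * (\<delta> s)\<^sup>2)\<close> minimises the exponent
    \<open>- t * a s + 4 * N * t\<^sup>2 * (\<delta> s)\<^sup>2\<close>; for \<open>s = 0\<close> it stays below 1, as \<open>exp_mid_log_le\<close> demands.\<close>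
  define a where "a s = \<alpha> * (3 / 4) ^ s * R" for s :: nat
  define t where "t s = \<alpha> * 3 ^ s / 8" for s :: nat
  have t0: "0 \<le> t s" for s by (simp add: t_def \<alpha>_def)
  define bad1 where "bad1 s D = {\<omega>\<in>space P. \<exists>n\<in>{1..2*N}. a s < (\<Sum>i=1..n. D (X i \<omega>) - integral\<^sup>L \<nu> D)}"
    for s and D :: "'a \<Rightarrow> real"
  define FZ where "FZ s = (\<lambda>g. Z s (c g)) ` H" for s
  have one: "prob (bad1 s (Z s (c g))) \<le> exp (- (2 * x * (9 / 4) ^ s))" if g: "g \<in> H" for s g
  proof -
    have exponent: "- (t s * a s) + real (2 * N) * ((t s)\<^sup>2 * (4 * (\<delta> s)\<^sup>2) / 2) = - (2 * x * (9 / 4) ^ s)"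
    proof -
      have 9: "(9::real) ^ s = 3 ^ s * 3 ^ s" "(4::real) ^ s = 2 ^ s * 2 ^ s"
        by (simp_all flip: power_mult_distrib)
      have "real (2 * N) * ((t s)\<^sup>2 * (4 * (\<delta> s)\<^sup>2) / 2) = 4 * R * ((3 ^ s)\<^sup>2 / (2 ^ s)\<^sup>2) * (\<alpha>\<^sup>2 / 64)"
        by (simp add: t_def \<delta>_def R_def power_mult_distrib power_divide)
      also have "\<dots> = R * \<alpha>\<^sup>2 / 16 * (9 / 4) ^ s"
        by (simp add: power2_eq_square 9 power_divide)
      finally have 1: "real (2 * N) * ((t s)\<^sup>2 * (4 * (\<delta> s)\<^sup>2) / 2) = R * \<alpha>\<^sup>2 / 16 * (9 / 4) ^ s" .
      have "t s * a s = R * \<alpha>\<^sup>2 / 8 * (3 ^ s * (3 / 4) ^ s)"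
        by (simp add: t_def a_def power2_eq_square)
      also have "\<dots> = R * \<alpha>\<^sup>2 / 8 * (9 / 4) ^ s"
        by (simp flip: power_mult_distrib)
      finally have 2: "t s * a s = R * \<alpha>\<^sup>2 / 8 * (9 / 4) ^ s" .
      show ?thesis unfolding 1 2 by (simp add: \<alpha>_def xR power2_eq_square)
    qed
    have "prob (bad1 s (Z s (c g))) \<le> exp (- (t s * a s) + real (2 * N) * ((t s)\<^sup>2 * (4 * (\<delta> s)\<^sup>2) / 2))"
    proof (cases s)
      case 0
      have "(\<integral>x. (U 0 (c g) x - 1)\<^sup>2 \<partial>\<nu>) \<le> 4 * (\<delta> 0)\<^sup>2"
        using U1_le[OF g, of 0] by (simp add: \<delta>_def)
      moreover have "exp (t 0 * Z 0 (c g) x) \<le> 1 + t 0 * Z 0 (c g) x + (t 0)\<^sup>2 * (U 0 (c g) x - 1)\<^sup>2 / 2" for x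
        using exp_mid_log_le[of "t 0" "U 0 (c g) x"] by (simp add: Z_def t_def \<alpha>_def)
      ultimately show ?thesis
        unfolding bad1_def 0
        by (intro partial_sum_deviation[where V="\<lambda>x. (U 0 (c g) x - 1)\<^sup>2"] Z_int g U1_int t0) auto
    next
      case (Suc r)
      note [measurable] = meas[OF g] Um[OF g]
      have range: "- (U r (c g) x - g x) \<le> Z s (c g) x" "Z s (c g) x \<le> 0" if "x \<in> space \<mu>" for x
        using mid_log_diff_le[OF U_anti[of r "c g" x]] mid_log_mono[OF U_anti[of r "c g" x]]
          U_ge[OF g that, of "Suc r"]
        by (auto simp: Z_def Suc)
      have sq: "(Z s (c g) x)\<^sup>2 \<le> (U r (c g) x - g x)\<^sup>2" if "x \<in> space \<mu>" for x
        using range[OF that] power_mono[of "- Z s (c g) x" "U r (c g) x - g x" 2] by simp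
      have i: "integrable \<nu> (\<lambda>x. (Z s (c g) x)\<^sup>2)"
        by (rule Bochner_Integration.integrable_bound[OF gap_int[OF g, of r]])
          (use sq Z_int[OF g, of s] in auto)
      have "(\<integral>x. (Z s (c g) x)\<^sup>2 \<partial>\<nu>) \<le> (\<integral>x. (U r (c g) x - g x)\<^sup>2 \<partial>\<nu>)"
        by (intro integral_mono i gap_int g) (use sq in auto)
      also have "\<dots> \<le> (\<delta> r)\<^sup>2" by (rule gap_le[OF g])
      also have "\<dots> = 4 * (\<delta> s)\<^sup>2" by (simp add: \<delta>_def Suc power_divide power_mult_distrib)
      finally have v: "(\<integral>x. (Z s (c g) x)\<^sup>2 \<partial>\<nu>) \<le> 4 * (\<delta> s)\<^sup>2" .
      have "exp (t s * Z s (c g) x) \<le> 1 + t s * Z s (c g) x + (t s)\<^sup>2 * (Z s (c g) x)\<^sup>2 / 2"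
        if "x \<in> space \<mu>" for x
        using exp_minus_le_quadratic[of "- (t s * Z s (c g) x)"] range(2)[OF that] t0[of s]
        by (simp add: power_mult_distrib mult_nonneg_nonpos)
      then show ?thesis
        unfolding bad1_def
        by (intro partial_sum_deviation[where V="\<lambda>x. (Z s (c g) x)\<^sup>2"] Z_int g i v t0) auto
    qed
    then show ?thesis unfolding exponent .
  qed
  \<comment> \<open>The increment at scale \<open>s\<close> depends only on the brackets chosen up to that scale, so finitely many
    increments occur.\<close>
  have Z_key: "Z s \<kappa> = Z s (restrict \<kappa> {..s})" for s \<kappa>
  proof -
    have "U r \<kappa> x = U r (restrict \<kappa> {..s}) x" if "r \<le> s" for r x
      unfolding U_def using that by (intro arg_cong[where f=Min] image_cong) auto
    then show ?thesis by (auto simp: Z_def fun_eq_iff split: nat.split)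
  qed
  have FZ_sub: "FZ s \<subseteq> Z s ` (PiE {..s} (\<lambda>r. {..<card_at r}))" for s
  proof
    fix D assume "D \<in> FZ s"
    then obtain g where g: "g \<in> H" "D = Z s (c g)" by (auto simp: FZ_def)
    have "restrict (c g) {..s} \<in> PiE {..s} (\<lambda>r. {..<card_at r})" using c[OF g(1)] by auto
    then show "D \<in> Z s ` (PiE {..s} (\<lambda>r. {..<card_at r}))"
      using g(2) Z_key[of s "c g"] by blast
  qed
  have fin: "finite (PiE {..s} (\<lambda>r. {..<card_at r}))" for s by (intro finite_PiE) auto
  have FZ_fin: "finite (FZ s)" for s
    using FZ_sub fin by (meson finite_imageI finite_subset)
  have FZ_card: "real (card (FZ s)) \<le> exp (x * (9 / 4) ^ s)" for s
  proof -
    have "card (FZ s) \<le> card (PiE {..s} (\<lambda>r. {..<card_at r}))"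
      using FZ_sub fin by (meson card_image_le card_mono finite_imageI order_trans)
    also have "\<dots> = (\<Prod>r\<le>s. card_at r)" by (simp add: card_PiE)
    finally have "real (card (FZ s)) \<le> (\<Prod>r\<le>s. real (card_at r))"
      by (metis of_nat_mono of_nat_prod)
    also have "\<dots> \<le> (\<Prod>r\<le>s. exp (e * (ln K + s)))"
    proof (intro prod_mono conjI)
      fix r assume r: "r \<in> {..s}"
      have "(K * 2 ^ r) powr e = exp (e * (ln K + r * ln 2))"
        using K by (simp add: powr_def ln_mult ln_realpow)
      also have "\<dots> \<le> exp (e * (ln K + s))"
      proof -
        have "real r * ln 2 \<le> real s * 1" using r ln_2_less_1 by (intro mult_mono) auto
        then show ?thesis using e by (auto intro!: mult_left_mono)
      qed
      finally show "real (card_at r) \<le> exp (e * (ln K + s))"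
        using card_at[of r] by linarith
    qed auto
    also have "\<dots> = exp ((real s + 1) * (e * (ln K + s)))"
      using exp_of_nat_mult[of "Suc s" "e * (ln K + s)"] by (simp add: add.commute)
    also have "\<dots> \<le> exp (x * (9 / 4) ^ s)"
    proof -
      have "ln K + real s \<le> (1 + ln K) * (real s + 1)"
        using K by (simp add: algebra_simps)
      then have "(real s + 1) * (e * (ln K + s)) \<le> (real s + 1) * (e * ((1 + ln K) * (real s + 1)))"
        using e by (intro mult_left_mono) auto
      also have "\<dots> = (e * (1 + ln K)) * (real s + 1)\<^sup>2"
        by (simp add: power2_eq_square)
      also have "\<dots> \<le> (e * (1 + ln K)) * (4 * (9 / 4) ^ s)"
        using e K by (intro mult_left_mono square_Suc_le_powr) auto
      also have "\<dots> = (4 * e * (1 + ln K)) * (9 / 4) ^ s" by simp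
      also have "\<dots> \<le> x * (9 / 4) ^ s" using large by (intro mult_right_mono) auto
      finally show ?thesis by simp
    qed
    finally show ?thesis .
  qed
  define bad where "bad s = (\<Union>D\<in>FZ s. bad1 s D)" for s
  have bad1_sets: "bad1 s D \<in> sets P" if "D \<in> FZ s" for s D
  proof -
    have [measurable]: "D \<in> borel_measurable \<mu>"
      using that borel_measurable_integrable[OF Z_int] by (auto simp: FZ_def cong: measurable_cong_sets)
    show ?thesis unfolding bad1_def by measurable
  qed
  have bad_sets: "bad s \<in> sets P" for s
    unfolding bad_def using FZ_fin bad1_sets by (intro sets.finite_UN) auto
  have bad_prob: "prob (bad s) \<le> exp (- x) ^ Suc s" for s
  proof -
    have "prob (bad s) \<le> (\<Sum>D\<in>FZ s. prob (bad1 s D))"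
      unfolding bad_def using FZ_fin bad1_sets by (intro finite_measure_subadditive_finite) auto
    also have "\<dots> \<le> (\<Sum>D\<in>FZ s. exp (- (2 * x * (9 / 4) ^ s)))"
      using one by (intro sum_mono) (auto simp: FZ_def)
    also have "\<dots> = real (card (FZ s)) * exp (- (2 * x * (9 / 4) ^ s))" by simp
    also have "\<dots> \<le> exp (x * (9 / 4) ^ s) * exp (- (2 * x * (9 / 4) ^ s))"
      by (intro mult_right_mono FZ_card) auto
    also have "\<dots> = exp (- (x * (9 / 4) ^ s))"
      by (simp add: mult_exp_exp)
    also have "\<dots> \<le> exp (- (x * (1 + real s)))"
    proof -
      have "1 + real s \<le> 1 + real s * (5 / 4)" by simp
      also have "\<dots> \<le> (1 + 5 / 4) ^ s" by (rule Bernoulli_inequality) auto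
      finally show ?thesis using large by simp
    qed
    also have "\<dots> = exp (- x) ^ Suc s"
      by (simp add: exp_of_nat_mult[symmetric] mult.commute exp_add[symmetric] algebra_simps)
    finally show ?thesis .
  qed
  have "exp (- x) \<le> 1 / 2"
  proof -
    have "2 \<le> exp x" using exp_ge_add_one_self[of x] large by linarith
    then show ?thesis by (simp add: exp_minus field_simps)
  qed
  then have "(\<lambda>s. exp (- x) ^ Suc s) sums (exp (- x) * (1 / (1 - exp (- x))))"
    using sums_mult[OF geometric_sums[of "exp (- x)"], of "exp (- x)"] large by simp
  from prob_UN_le_sums[OF bad_sets bad_prob this]
  have "prob (\<Union>s. bad s) \<le> exp (- x) * (1 / (1 - exp (- x)))" .
  also have "\<dots> \<le> exp (- x) * 2"
  proof (intro mult_left_mono)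
    have "1 / (1 - exp (- x)) \<le> 1 / (1 / 2)"
      using \<open>exp (- x) \<le> 1 / 2\<close> large by (intro divide_left_mono) auto
    then show "1 / (1 - exp (- x)) \<le> 2" by simp
  qed simp
  finally have B_prob: "prob (\<Union>s. bad s) \<le> 2 * exp (- x)" by simp
  have "(\<Sum>i=1..n. mid_log (g (X i \<omega>))) \<le> n * (\<integral>x. mid_log (g x) \<partial>\<nu>) + N * \<epsilon>\<^sup>2 / 32"
    if \<omega>: "\<omega> \<in> space P" "\<omega> \<notin> (\<Union>s. bad s)" and n: "n \<in> {1..2*N}" and g: "g \<in> H" for \<omega> n g
  proof -
    note [measurable] = meas[OF g] Um[OF g]
    have Xs: "X i \<omega> \<in> space \<mu>" if "i \<in> {1..n}" for i
      using that \<omega> by (intro X_space) auto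
    have Z_le: "(\<Sum>i=1..n. Z s (c g) (X i \<omega>)) \<le> n * integral\<^sup>L \<nu> (Z s (c g)) + a s" for s
    proof -
      have "\<omega> \<notin> bad1 s (Z s (c g))" using \<omega> g by (auto simp: bad_def FZ_def)
      then have "\<not> a s < (\<Sum>i=1..n. Z s (c g) (X i \<omega>) - integral\<^sup>L \<nu> (Z s (c g)))"
        using \<omega>(1) n by (auto simp: bad1_def)
      then show ?thesis by (simp add: sum_subtractf)
    qed
    \<comment> \<open>Stopping the chain at scale \<open>S\<close> biases the mean by at most the width of the last bracket.\<close>
    have "(\<Sum>i=1..n. mid_log (g (X i \<omega>))) \<le> n * (\<integral>x. mid_log (g x) \<partial>\<nu>) + R / 40 + n * \<epsilon> * (1 / 2) ^ S" for S
    proof -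
      have "(\<Sum>s\<le>S. (3 / 4 :: real) ^ s) \<le> 4"
        by (subst sum_gp0) (simp add: field_simps)
      then have "\<alpha> * R * (\<Sum>s\<le>S. (3 / 4) ^ s) \<le> \<alpha> * R * 4"
        using R0 by (intro mult_left_mono) (auto simp: \<alpha>_def)
      then have a_sum: "(\<Sum>s\<le>S. a s) \<le> R / 40"
      proof -
        have "a s = \<alpha> * R * (3 / 4) ^ s" for s by (simp add: a_def)
        then have "(\<Sum>s\<le>S. a s) = \<alpha> * R * (\<Sum>s\<le>S. (3 / 4) ^ s)"
          by (simp only: sum_distrib_left)
        then show ?thesis using \<open>\<alpha> * R * _ \<le> _\<close> by (simp add: \<alpha>_def)
      qed
      have gap_meas: "(\<lambda>x. U S (c g) x - g x) \<in> borel_measurable \<nu>"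
        by measurable
      have gap_int1: "integrable \<nu> (\<lambda>x. U S (c g) x - g x)"
        by (rule \<nu>.square_integrable_imp_integrable[OF gap_meas gap_int[OF g]])
      have "(\<integral>x. mid_log (U S (c g) x) - mid_log (g x) \<partial>\<nu>) \<le> (\<integral>x. U S (c g) x - g x \<partial>\<nu>)"
        by (rule integral_mono[OF Bochner_Integration.integrable_diff[OF mlU[OF g] mlg[OF g]] gap_int1])
          (simp add: mid_log_diff_le U_ge g)
      also have "\<dots> \<le> \<delta> S"
        by (rule \<nu>.integral_le_L2[OF gap_meas gap_int[OF g] gap_le[OF g] less_imp_le[OF \<delta>(1)]])
      finally have "(\<integral>x. mid_log (U S (c g) x) \<partial>\<nu>) \<le> (\<integral>x. mid_log (g x) \<partial>\<nu>) + \<epsilon> * (1 / 2) ^ S"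
        using mlU[OF g] mlg[OF g] by (simp add: \<delta>_def power_divide)
      then have bias: "n * (\<integral>x. mid_log (U S (c g) x) \<partial>\<nu>)
          \<le> n * ((\<integral>x. mid_log (g x) \<partial>\<nu>) + \<epsilon> * (1 / 2) ^ S)"
        by (rule mult_left_mono) simp
      have "(\<Sum>i=1..n. mid_log (g (X i \<omega>))) \<le> (\<Sum>i=1..n. mid_log (U S (c g) (X i \<omega>)))"
        using Xs by (intro sum_mono mid_log_mono U_ge g) auto
      also have "\<dots> = (\<Sum>s\<le>S. \<Sum>i=1..n. Z s (c g) (X i \<omega>))"
        unfolding Z_sum[symmetric] by (rule sum.swap)
      also have "\<dots> \<le> (\<Sum>s\<le>S. n * integral\<^sup>L \<nu> (Z s (c g)) + a s)"
        by (intro sum_mono Z_le)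
      also have "\<dots> = n * (\<Sum>s\<le>S. integral\<^sup>L \<nu> (Z s (c g))) + (\<Sum>s\<le>S. a s)"
        by (simp add: sum.distrib sum_distrib_left)
      also have "(\<Sum>s\<le>S. integral\<^sup>L \<nu> (Z s (c g))) = (\<integral>x. mid_log (U S (c g) x) \<partial>\<nu>)"
        unfolding Z_sum[symmetric] using Z_int[OF g]
        by (intro Bochner_Integration.integral_sum[symmetric]) auto
      finally show ?thesis
        using a_sum bias by (simp add: distrib_left)
    qed
    moreover have "(\<lambda>S. n * (\<integral>x. mid_log (g x) \<partial>\<nu>) + R / 40 + n * \<epsilon> * (1 / 2) ^ S)
        \<longlonglongrightarrow> n * (\<integral>x. mid_log (g x) \<partial>\<nu>) + R / 40 + n * \<epsilon> * 0"
      by (intro tendsto_intros LIMSEQ_realpow_zero) auto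
    ultimately have "(\<Sum>i=1..n. mid_log (g (X i \<omega>))) \<le> n * (\<integral>x. mid_log (g x) \<partial>\<nu>) + R / 40 + n * \<epsilon> * 0"
      by (intro LIMSEQ_le_const[of _ _ "\<Sum>i=1..n. mid_log (g (X i \<omega>))"]) auto
    moreover have "R / 40 \<le> R / 32" using R0 by simp
    ultimately show ?thesis unfolding R_def by linarith
  qed
  moreover have "(\<Union>s. bad s) \<in> sets P" using bad_sets by auto
  ultimately show ?thesis using B_prob by blast
qed

text \<open>An infimum of extended naturals that is finite is attained.\<close>
lemma bracket_cover_of_bracketing_number:
  assumes "ereal_of_enat (bracketing_number \<nu> Q \<delta>) \<le> ereal r"
  shows "\<exists>n. bracket_cover \<nu> Q \<delta> n \<and> real n \<le> r"
proof -
  let ?S = "{enat N |N. bracket_cover \<nu> Q \<delta> N}"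
  have "?S \<noteq> {}"
  proof
    assume "?S = {}"
    then have "bracketing_number \<nu> Q \<delta> = \<infinity>"
      unfolding bracketing_number_def by (simp only: Inf_enat_def if_True refl)
    then show False using assms by simp
  qed
  then have "Inf ?S \<in> ?S"
    unfolding Inf_enat_def using LeastI_ex[of "\<lambda>x. x \<in> ?S"] by auto
  then obtain n where "bracketing_number \<nu> Q \<delta> = enat n" "bracket_cover \<nu> Q \<delta> n"
    by (auto simp: bracketing_number_def)
  then show ?thesis using assms by auto
qed

section \<open>Hellinger geometry under the true density\<close>

locale density_sample = iid_sample P \<mu> "density \<mu> (\<lambda>x. ennreal (f\<^sub>0 x))" X
  for P :: "'w measure" and \<mu> :: "'a measure" and f\<^sub>0 :: "'a \<Rightarrow> real" and X +
  assumes f0_density: "pos_prob_density \<mu> f\<^sub>0"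
begin

abbreviation (input) \<nu> :: "'a measure" where
  "\<nu> \<equiv> density \<mu> (\<lambda>x. ennreal (f\<^sub>0 x))"

abbreviation root_ratio :: "('a \<Rightarrow> real) \<Rightarrow> 'a \<Rightarrow> real" where
  "root_ratio f x \<equiv> sqrt (f x / f\<^sub>0 x)"

lemma f0_measurable [measurable]: "f\<^sub>0 \<in> borel_measurable \<mu>"
  and f0_pos: "AE x in \<mu>. 0 < f\<^sub>0 x"
  using f0_density by (auto simp: pos_prob_density_def)

lemma AE_transfer:
  assumes "AE x in \<mu>. Q x"
  shows "AE x in \<nu>. Q x"
  using assms by (subst AE_density) auto

text \<open>
  Change of measure, stated up to null sets because the identities below divide by densities that
  are positive only almost everywhere.
\<close>
lemma
  fixes u v :: "'a \<Rightarrow> real"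
  assumes [measurable]: "u \<in> borel_measurable \<mu>" "v \<in> borel_measurable \<mu>"
    and eq: "AE x in \<mu>. f\<^sub>0 x * u x = v x"
  shows integrable_weighted: "integrable \<nu> u \<longleftrightarrow> integrable \<mu> v"
    and integral_weighted: "(\<integral>x. u x \<partial>\<nu>) = (\<integral>x. v x \<partial>\<mu>)"
proof -
  have nn: "AE x in \<mu>. 0 \<le> f\<^sub>0 x" using f0_pos by eventually_elim simp
  have "integrable \<nu> u \<longleftrightarrow> integrable \<mu> (\<lambda>x. f\<^sub>0 x * u x)"
    using nn by (subst integrable_density) auto
  also have "\<dots> \<longleftrightarrow> integrable \<mu> v"
    using eq by (intro integrable_cong_AE) auto
  finally show "integrable \<nu> u \<longleftrightarrow> integrable \<mu> v" .
  have "(\<integral>x. u x \<partial>\<nu>) = (\<integral>x. f\<^sub>0 x * u x \<partial>\<mu>)"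
    using nn by (subst integral_density) auto
  also have "\<dots> = (\<integral>x. v x \<partial>\<mu>)"
    using eq by (intro integral_cong_AE) auto
  finally show "(\<integral>x. u x \<partial>\<nu>) = (\<integral>x. v x \<partial>\<mu>)" .
qed

context
  fixes f :: "'a \<Rightarrow> real"
  assumes f: "pos_prob_density \<mu> f"
begin

lemma f_measurable: "f \<in> borel_measurable \<mu>"
  and f_pos: "AE x in \<mu>. 0 < f x"
  using f by (auto simp: pos_prob_density_def)

lemma root_ratio_measurable: "root_ratio f \<in> borel_measurable \<mu>"
  using f_measurable by measurable

lemma root_ratio_pos: "AE x in \<nu>. 0 < root_ratio f x"
  using AE_transfer[OF f0_pos] AE_transfer[OF f_pos] by eventually_elim simp

lemma weighted_hellinger_integrand:
  "AE x in \<mu>. f\<^sub>0 x * (root_ratio f x - 1)\<^sup>2 = (sqrt (f x) - sqrt (f\<^sub>0 x))\<^sup>2"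
  using f0_pos f_pos
proof eventually_elim
  case (elim x)
  have "f\<^sub>0 x * (root_ratio f x - 1)\<^sup>2 = (sqrt (f\<^sub>0 x) * (root_ratio f x - 1))\<^sup>2"
    using elim by (simp add: power_mult_distrib)
  also have "sqrt (f\<^sub>0 x) * (root_ratio f x - 1) = sqrt (f x) - sqrt (f\<^sub>0 x)"
    using elim by (simp add: real_sqrt_divide right_diff_distrib)
  finally show ?case .
qed

lemma weighted_square: "AE x in \<mu>. f\<^sub>0 x * (root_ratio f x)\<^sup>2 = f x"
  using f0_pos f_pos by eventually_elim simp

lemma root_ratio_square:
  "integrable \<nu> (\<lambda>x. (root_ratio f x)\<^sup>2)" "(\<integral>x. (root_ratio f x)\<^sup>2 \<partial>\<nu>) = 1"
proof -
  note [measurable] = f_measurable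
  have m: "(\<lambda>x. (root_ratio f x)\<^sup>2) \<in> borel_measurable \<mu>" by measurable
  show "integrable \<nu> (\<lambda>x. (root_ratio f x)\<^sup>2)" "(\<integral>x. (root_ratio f x)\<^sup>2 \<partial>\<nu>) = 1"
    using integrable_weighted[OF m f_measurable weighted_square]
      integral_weighted[OF m f_measurable weighted_square] f
    by (simp_all add: pos_prob_density_def)
qed

lemma root_ratio_integrable: "integrable \<nu> (root_ratio f)"
proof -
  interpret \<nu>: prob_space \<nu> by (rule prob_space_law)
  show ?thesis
    by (rule \<nu>.square_integrable_imp_integrable[OF _ root_ratio_square(1)])
      (simp add: root_ratio_measurable)
qed

lemma root_ratio_dist_integrable: "integrable \<nu> (\<lambda>x. (root_ratio f x - 1)\<^sup>2)"
proof -
  interpret \<nu>: prob_space \<nu> by (rule prob_space_law)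
  show ?thesis
    using root_ratio_square(1) root_ratio_integrable by (simp add: power2_diff)
qed

lemma hellinger_square: "(\<integral>x. (root_ratio f x - 1)\<^sup>2 \<partial>\<nu>) = (hellinger \<mu> f f\<^sub>0)\<^sup>2"
proof -
  note [measurable] = f_measurable
  have m: "(\<lambda>x. (root_ratio f x - 1)\<^sup>2) \<in> borel_measurable \<mu>"
    "(\<lambda>x. (sqrt (f x) - sqrt (f\<^sub>0 x))\<^sup>2) \<in> borel_measurable \<mu>" by measurable
  have "0 \<le> (\<integral>x. (sqrt (f x) - sqrt (f\<^sub>0 x))\<^sup>2 \<partial>\<mu>)"
    by (rule Bochner_Integration.integral_nonneg) simp
  then show ?thesis
    unfolding hellinger_def by (simp only: real_sqrt_pow2 integral_weighted[OF m weighted_hellinger_integrand])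
qed

text \<open>Expand the square in \<open>hellinger_square\<close>; both densities have total mass 1.\<close>
lemma expectation_root_ratio: "(\<integral>x. root_ratio f x \<partial>\<nu>) = 1 - (hellinger \<mu> f f\<^sub>0)\<^sup>2 / 2"
proof -
  interpret \<nu>: prob_space \<nu> by (rule prob_space_law)
  have "(hellinger \<mu> f f\<^sub>0)\<^sup>2 = (\<integral>x. (root_ratio f x)\<^sup>2 + 1 - 2 * root_ratio f x \<partial>\<nu>)"
    unfolding hellinger_square[symmetric] by (simp add: power2_diff)
  also have "\<dots> = 2 - 2 * (\<integral>x. root_ratio f x \<partial>\<nu>)"
    using root_ratio_square root_ratio_integrable \<nu>.prob_space by simp
  finally show ?thesis by (simp add: field_simps)
qed

text \<open>The negative drift: away from \<open>f\<^sub>0\<close>, each observation costs \<open>h\<^sup>2 / 4\<close> on average.\<close>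
lemma expectation_mid_log_le:
  "(\<integral>x. mid_log (root_ratio f x) \<partial>\<nu>) \<le> - (hellinger \<mu> f f\<^sub>0)\<^sup>2 / 4"
proof -
  interpret \<nu>: prob_space \<nu> by (rule prob_space_law)
  have "(\<integral>x. mid_log (root_ratio f x) \<partial>\<nu>) \<le> (\<integral>x. (root_ratio f x - 1) / 2 \<partial>\<nu>)"
  proof (rule integral_mono_AE)
    show "integrable \<nu> (\<lambda>x. mid_log (root_ratio f x))"
      using root_ratio_measurable root_ratio_dist_integrable by (intro \<nu>.integrable_mid_log) auto
    show "integrable \<nu> (\<lambda>x. (root_ratio f x - 1) / 2)"
      using root_ratio_integrable by simp
    show "AE x in \<nu>. mid_log (root_ratio f x) \<le> (root_ratio f x - 1) / 2"
      using root_ratio_pos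
    proof eventually_elim
      case (elim x)
      then show ?case using mid_log_le_linear[of "root_ratio f x"] by (simp add: max_def)
    qed
  qed
  also have "\<dots> = - (hellinger \<mu> f f\<^sub>0)\<^sup>2 / 4"
    using root_ratio_integrable expectation_root_ratio \<nu>.prob_space by simp
  finally show ?thesis .
qed

text \<open>
  With \<open>y = sqrt (f / f\<^sub>0) - 1\<close> the integrand is \<open>f\<^sub>0 * \<bar>y\<^sup>2 + 2 * y\<bar>\<close>. This turns
  separation from \<open>f\<^sub>0\<close> in \<open>L\<^sup>1\<close> into separation in Hellinger distance.
\<close>
lemma L1_dist_le_hellinger:
  "(\<integral>x. \<bar>f\<^sub>0 x - f x\<bar> \<partial>\<mu>) \<le> (hellinger \<mu> f f\<^sub>0)\<^sup>2 + 2 * hellinger \<mu> f f\<^sub>0"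
proof -
  interpret \<nu>: prob_space \<nu> by (rule prob_space_law)
  note [measurable] = f_measurable root_ratio_measurable
  have eq: "AE x in \<mu>. f\<^sub>0 x * \<bar>(root_ratio f x)\<^sup>2 - 1\<bar> = \<bar>f\<^sub>0 x - f x\<bar>"
    using f0_pos f_pos
  proof eventually_elim
    case (elim x)
    have "f\<^sub>0 x * \<bar>(root_ratio f x)\<^sup>2 - 1\<bar> = \<bar>f\<^sub>0 x * ((root_ratio f x)\<^sup>2 - 1)\<bar>"
      using elim by (simp add: abs_mult)
    also have "f\<^sub>0 x * ((root_ratio f x)\<^sup>2 - 1) = f x - f\<^sub>0 x"
      using elim by (simp add: right_diff_distrib)
    finally show ?case by (simp add: abs_minus_commute)
  qed
  have m: "(\<lambda>x. \<bar>(root_ratio f x)\<^sup>2 - 1\<bar>) \<in> borel_measurable \<mu>"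
    "(\<lambda>x. \<bar>f\<^sub>0 x - f x\<bar>) \<in> borel_measurable \<mu>" by measurable
  have h0: "0 \<le> hellinger \<mu> f f\<^sub>0" by (simp add: hellinger_def)
  have i1: "integrable \<nu> (\<lambda>x. \<bar>root_ratio f x - 1\<bar>)"
    using root_ratio_integrable by auto
  have "(\<integral>x. \<bar>f\<^sub>0 x - f x\<bar> \<partial>\<mu>) = (\<integral>x. \<bar>(root_ratio f x)\<^sup>2 - 1\<bar> \<partial>\<nu>)"
    using integral_weighted[OF m eq] by simp
  also have "\<dots> \<le> (\<integral>x. (root_ratio f x - 1)\<^sup>2 + 2 * \<bar>root_ratio f x - 1\<bar> \<partial>\<nu>)"
  proof (intro integral_mono)
    show "integrable \<nu> (\<lambda>x. \<bar>(root_ratio f x)\<^sup>2 - 1\<bar>)"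
      using root_ratio_square by auto
    show "integrable \<nu> (\<lambda>x. (root_ratio f x - 1)\<^sup>2 + 2 * \<bar>root_ratio f x - 1\<bar>)"
      using root_ratio_dist_integrable i1 by auto
    fix x
    define y where "y = root_ratio f x - 1"
    have "\<bar>(root_ratio f x)\<^sup>2 - 1\<bar> = \<bar>y\<^sup>2 + 2 * y\<bar>"
      by (simp only: y_def) (simp add: power2_eq_square algebra_simps)
    also have "\<dots> \<le> \<bar>y\<^sup>2\<bar> + \<bar>2 * y\<bar>" by (rule abs_triangle_ineq)
    also have "\<dots> = y\<^sup>2 + 2 * \<bar>y\<bar>" by (simp only: abs_mult) simp
    finally show "\<bar>(root_ratio f x)\<^sup>2 - 1\<bar> \<le> (root_ratio f x - 1)\<^sup>2 + 2 * \<bar>root_ratio f x - 1\<bar>"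
      unfolding y_def .
  qed
  also have "\<dots> = (hellinger \<mu> f f\<^sub>0)\<^sup>2 + 2 * (\<integral>x. \<bar>root_ratio f x - 1\<bar> \<partial>\<nu>)"
    using root_ratio_dist_integrable i1 hellinger_square by simp
  also have "(\<integral>x. \<bar>root_ratio f x - 1\<bar> \<partial>\<nu>) \<le> hellinger \<mu> f f\<^sub>0"
  proof (rule \<nu>.integral_le_L2[OF _ _ _ h0])
    show "(\<lambda>x. \<bar>root_ratio f x - 1\<bar>) \<in> borel_measurable \<nu>" by measurable
    show "integrable \<nu> (\<lambda>x. \<bar>root_ratio f x - 1\<bar>\<^sup>2)"
      using root_ratio_dist_integrable by (simp only: power2_abs)
    show "(\<integral>x. \<bar>root_ratio f x - 1\<bar>\<^sup>2 \<partial>\<nu>) \<le> (hellinger \<mu> f f\<^sub>0)\<^sup>2"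
      by (simp only: power2_abs hellinger_square)
  qed
  finally show ?thesis by simp
qed

lemma loglik_le_sum_mid_log:
  "AE \<omega> in P. loglik X n f \<omega> \<le> loglik X n f\<^sub>0 \<omega> + 4 * (\<Sum>i=1..n. mid_log (root_ratio f (X i \<omega>)))"
proof -
  have "AE x in \<nu>. ln (f x) \<le> ln (f\<^sub>0 x) + 4 * mid_log (root_ratio f x)"
    using AE_transfer[OF f0_pos] AE_transfer[OF f_pos]
  proof eventually_elim
    case (elim x)
    then have "ln (f x) - ln (f\<^sub>0 x) = 2 * ln (root_ratio f x)"
      by (simp add: ln_sqrt ln_div)
    then show ?case using ln_le_mid_log[of "root_ratio f x"] elim by simp
  qed
  then have "AE \<omega> in P. \<forall>i\<in>{1..n}. ln (f (X i \<omega>)) \<le> ln (f\<^sub>0 (X i \<omega>)) + 4 * mid_log (root_ratio f (X i \<omega>))"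
    using AE_law by (subst AE_ball_countable) auto
  then show ?thesis
  proof eventually_elim
    case (elim \<omega>)
    then have "(\<Sum>i=1..n. ln (f (X i \<omega>)))
        \<le> (\<Sum>i=1..n. ln (f\<^sub>0 (X i \<omega>)) + 4 * mid_log (root_ratio f (X i \<omega>)))"
      by (intro sum_mono) blast
    then show ?case by (simp add: loglik_def sum.distrib sum_distrib_left)
  qed
qed

end

end

section \<open>A uniform bound on likelihood ratios\<close>

lemma (in prob_space) prob_UN2_geometric_le:
  fixes B :: "nat \<Rightarrow> nat \<Rightarrow> 'a set"
  assumes B: "\<And>q j. B q j \<in> sets M" and c: "0 \<le> c"
    and le: "\<And>q j. prob (B q j) \<le> c * (1 / 2) ^ q * (1 / 2) ^ j"
  shows "prob (\<Union>q j. B q j) \<le> 4 * c"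
proof -
  have geo: "(\<lambda>j. b * (1 / 2) ^ j) sums (b * 2)" for b :: real
    using sums_mult[OF geometric_sums[of "1 / 2 :: real"], of b] by simp
  have "prob (\<Union>j. B q j) \<le> c * 2 * (1 / 2) ^ q" for q
  proof -
    have "prob (\<Union>j. B q j) \<le> c * (1 / 2) ^ q * 2"
      by (rule prob_UN_le_sums[OF B le geo])
    also have "\<dots> = c * 2 * (1 / 2) ^ q" by simp
    finally show ?thesis .
  qed
  moreover have "(\<Union>j. B q j) \<in> sets M" for q using B by auto
  ultimately have "prob (\<Union>q. \<Union>j. B q j) \<le> c * 2 * 2"
    using prob_UN_le_sums[OF _ _ geo[of "c * 2"], of "\<lambda>q. \<Union>j. B q j"] by blast
  then show ?thesis by simp
qed

text \<open>
  Summability over all three indices. With \<open>q\<close> the order, \<open>j\<close> the shell and \<open>k\<close> the block, the exponent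
  \<open>4 ^ j * y * ln k\<close> is at least \<open>(2 + q + j) * ln k\<close>: the 2 gives the summable \<open>1 / k\<^sup>2\<close>, and
  \<open>ln k \<ge> 1\<close> turns the rest into geometric factors in \<open>q\<close> and \<open>j\<close>.
\<close>
lemma dyadic_tail_exponent:
  fixes k q j :: nat
  assumes k: "3 \<le> k" and q: "1 \<le> q" and y: "4 * real q \<le> y"
  shows "exp (- (4 ^ j * y * ln k)) \<le> 1 / (real k)\<^sup>2 * (1 / 2) ^ q * (1 / 2) ^ j"
proof -
  have ln: "1 \<le> ln (real k)"
    using ln_ge_iff[of "real k" 1] exp_le k by simp
  have "1 + real j * 3 \<le> (1 + 3) ^ j"
    by (rule Bernoulli_inequality) simp
  then have "1 + real j \<le> 4 ^ j" by simp
  have "real (2 + q + j) \<le> real ((1 + j) * (4 * q))"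
    using q by (intro of_nat_mono) (cases q; simp add: algebra_simps)
  also have "\<dots> = (1 + real j) * (4 * real q)"
    by (simp add: algebra_simps)
  also have "\<dots> \<le> 4 ^ j * y"
    using y \<open>1 + real j \<le> 4 ^ j\<close> by (intro mult_mono) auto
  finally have "real (2 + q + j) * ln k \<le> 4 ^ j * y * ln k"
    using ln by (intro mult_right_mono) auto
  moreover have "real (q + j) * 1 \<le> real (q + j) * ln k"
    using ln by (intro mult_left_mono) auto
  ultimately have "- (4 ^ j * y * ln k) \<le> - (2 * ln k) - real (q + j)"
    by (simp add: algebra_simps)
  then have "exp (- (4 ^ j * y * ln k)) \<le> exp (- (2 * ln k) - real (q + j))"
    by simp
  also have "\<dots> = 1 / (real k)\<^sup>2 * exp (- 1) ^ (q + j)"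
  proof -
    have "exp (2 * ln (real k)) = (real k)\<^sup>2"
      using k by (simp add: exp_double)
    moreover have "exp (- 1) ^ (q + j) = exp (- real (q + j))"
      using exp_of_nat_mult[of "q + j" "- 1 :: real"] by simp
    ultimately show ?thesis by (simp add: exp_diff exp_minus exp_add field_simps)
  qed
  also have "\<dots> \<le> 1 / (real k)\<^sup>2 * (1 / 2) ^ (q + j)"
  proof (intro mult_left_mono power_mono)
    have "2 \<le> exp (1 :: real)" using exp_ge_add_one_self[of 1] by simp
    then show "exp (- 1 :: real) \<le> 1 / 2" by (simp add: exp_minus field_simps)
  qed auto
  finally show ?thesis by (simp add: power_add)
qed

lemma ln_dyadic_index_le:
  assumes "1 \<le> k" "2 ^ k \<le> n"
  shows "ln (real k) \<le> ln (ln (real n)) + 1"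
proof -
  have n: "2 ^ k \<le> real n" using assms(2) by (metis of_nat_le_iff of_nat_numeral of_nat_power)
  then have "ln (2 ^ k) \<le> ln (real n)" by (subst ln_le_cancel_iff) (auto intro: less_le_trans[of _ "2 ^ k"])
  then have kn: "real k * ln 2 \<le> ln (real n)" by (simp add: ln_realpow)
  have "1 / 2 \<le> ln (2 :: real)" using ln2_ge_two_thirds by simp
  then have "real k * (1 / 2) \<le> real k * ln 2" by (intro mult_left_mono) auto
  then have "real k \<le> 2 * ln (real n)" using kn by simp
  moreover have "0 < ln (real n)" using calculation assms(1) by linarith
  ultimately have "ln (real k) \<le> ln (2 * ln (real n))" using assms(1) by (subst ln_le_cancel_iff) auto
  also have "\<dots> = ln 2 + ln (ln (real n))" using \<open>0 < ln (real n)\<close> by (simp add: ln_mult)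
  finally show ?thesis using ln_2_less_1 by simp
qed

text \<open>
  The events \<open>G n\<close> appear explicitly because the bound has to be turned into a statement about
  essential suprema at each fixed \<open>n\<close>, for which one needs a measurable event on which it holds for
  all densities simultaneously.
\<close>
lemma (in density_sample) likelihood_ratio_bound:
  fixes \<M> :: "nat \<Rightarrow> ('a \<Rightarrow> real) set" and \<eta> :: "nat \<Rightarrow> real" and K :: real and q\<^sub>0 :: nat
  assumes q0: "1 \<le> q\<^sub>0" and K: "1 \<le> K"
    and dens: "\<And>q f. q\<^sub>0 \<le> q \<Longrightarrow> f \<in> \<M> q \<Longrightarrow> pos_prob_density \<mu> f"
    and eta: "\<And>q. q\<^sub>0 \<le> q \<Longrightarrow> real q \<le> \<eta> q"
    and entropy: "\<And>q \<epsilon> \<delta>. q\<^sub>0 \<le> q \<Longrightarrow> 0 < \<delta> \<Longrightarrow> \<delta> \<le> \<epsilon> \<Longrightarrow>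
        ereal_of_enat (bracketing_number \<nu> (hellinger_ball \<mu> f\<^sub>0 (\<M> q) \<epsilon>) \<delta>)
          \<le> ereal ((K * \<epsilon> / \<delta>) powr \<eta> q)"
  shows "\<exists>C\<ge>0. \<exists>G. (\<forall>n. G n \<in> sets P) \<and> (AE \<omega> in P. \<forall>\<^sub>F n in sequentially. \<omega> \<in> G n) \<and>
    (\<forall>n. \<forall>\<omega>\<in>G n. \<forall>q\<ge>q\<^sub>0. \<forall>f\<in>\<M> q.
       (\<Sum>i=1..n. mid_log (root_ratio f (X i \<omega>)))
         \<le> C * \<eta> q * (ln (ln n) + 1) - n * (hellinger \<mu> f f\<^sub>0)\<^sup>2 / 8)"
proof -
  define c where "c = 4 * (1 + ln K)"
  have c4: "4 \<le> c" using K by (simp add: c_def)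
  \<comment> \<open>The radius of shell \<open>j\<close> in block \<open>k\<close>, chosen so that the \<open>x\<close> of \<open>chaining_deviation\<close> equals
    \<open>4 ^ j * c * \<eta> q * ln k\<close>; for \<open>k \<ge> 3\<close> this is at least \<open>c * \<eta> q\<close>, which pays for the entropy.\<close>
  define \<epsilon> where "\<epsilon> k q j = 2 ^ j * sqrt (819200 * (c * \<eta> q * ln (real k)) / 2 ^ k)"
    for k q j :: nat
  have ln_k: "1 \<le> ln (real k)" if "3 \<le> k" for k :: nat
    using ln_ge_iff[of "real k" 1] exp_le that by simp
  have y: "4 * real q \<le> c * \<eta> q" if "q\<^sub>0 \<le> q" for q
    using c4 eta[OF that] by (intro mult_mono) auto
  have rate: "0 \<le> c * \<eta> q * ln (real k)" if "3 \<le> k" "q\<^sub>0 \<le> q" for k q :: nat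
    using y[of q] ln_k[of k] that by (intro mult_nonneg_nonneg[of "c * \<eta> q"]) linarith+
  have scale: "real (2 ^ k) * (\<epsilon> k q j)\<^sup>2 = 819200 * (4 ^ j * (c * \<eta> q) * ln (real k))"
    if "3 \<le> k" "q\<^sub>0 \<le> q" for k q j
    using rate[OF that] power_mult[of "2 :: real" 2 j]
    by (simp add: \<epsilon>_def power_mult_distrib power_mult[symmetric] mult.commute[of j 2])
  define good where "good k q j B \<longleftrightarrow> (3 \<le> k \<longrightarrow> q\<^sub>0 \<le> q \<longrightarrow>
      (\<forall>\<omega>\<in>space P - B. \<forall>n\<in>{1..2*2^k}. \<forall>g\<in>hellinger_ball \<mu> f\<^sub>0 (\<M> q) (\<epsilon> k q j).
        (\<Sum>i=1..n. mid_log (g (X i \<omega>)))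
          \<le> n * (\<integral>x. mid_log (g x) \<partial>\<nu>) + real (2 ^ k) * (\<epsilon> k q j)\<^sup>2 / 32))" for k q j B
  have "\<exists>B. B \<in> sets P \<and> prob B \<le> 2 / (real k)\<^sup>2 * (1 / 2) ^ q * (1 / 2) ^ j \<and> good k q j B"
    for k q j
  proof (cases "3 \<le> k \<and> q\<^sub>0 \<le> q")
    case False
    then show ?thesis by (intro exI[of _ "{}"]) (auto simp: good_def)
  next
    case True
    then have kq: "3 \<le> k" "q\<^sub>0 \<le> q" and q1: "1 \<le> q" using q0 by auto
    have pos: "0 < \<epsilon> k q j"
      using y[OF kq(2)] q1 ln_k[OF kq(1)] by (auto simp: \<epsilon>_def intro!: mult_pos_pos divide_pos_pos)
    define x where "x = 4 ^ j * (c * \<eta> q) * ln (real k)"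
    have x_eq: "x = real (2 ^ k) * (\<epsilon> k q j)\<^sup>2 / 819200"
      unfolding scale[OF kq] x_def by simp
    have e0: "0 \<le> \<eta> q" using eta[OF kq(2)] by simp
    have "1 * (c * \<eta> q) * 1 \<le> x"
      unfolding x_def using c4 e0 ln_k[OF kq(1)] by (intro mult_mono) auto
    then have x: "4 * \<eta> q * (1 + ln K) \<le> x" "1 \<le> x"
      using y[OF kq(2)] q1 by (auto simp: c_def mult.commute mult.left_commute)
    have ball: "\<exists>f. pos_prob_density \<mu> f \<and> g = root_ratio f \<and> hellinger \<mu> f f\<^sub>0 \<le> \<epsilon> k q j"
      if "g \<in> hellinger_ball \<mu> f\<^sub>0 (\<M> q) (\<epsilon> k q j)" for g
      using that dens[OF kq(2)] unfolding hellinger_ball_def by blast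
    have 1: "g \<in> borel_measurable \<mu>" "integrable \<nu> (\<lambda>x. (g x - 1)\<^sup>2)"
      "(\<integral>x. (g x - 1)\<^sup>2 \<partial>\<nu>) \<le> (\<epsilon> k q j)\<^sup>2"
      if "g \<in> hellinger_ball \<mu> f\<^sub>0 (\<M> q) (\<epsilon> k q j)" for g
    proof -
      from ball[OF that] obtain f
        where f: "pos_prob_density \<mu> f" "g = root_ratio f" "hellinger \<mu> f f\<^sub>0 \<le> \<epsilon> k q j"
        by blast
      show "g \<in> borel_measurable \<mu>" "integrable \<nu> (\<lambda>x. (g x - 1)\<^sup>2)"
        unfolding f(2) by (rule root_ratio_measurable[OF f(1)], rule root_ratio_dist_integrable[OF f(1)])
      have "0 \<le> hellinger \<mu> f f\<^sub>0" by (simp add: hellinger_def)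
      then show "(\<integral>x. (g x - 1)\<^sup>2 \<partial>\<nu>) \<le> (\<epsilon> k q j)\<^sup>2"
        unfolding f(2) hellinger_square[OF f(1)] using f(3) by (intro power_mono)
    qed
    have "\<exists>B\<in>sets P. prob B \<le> 2 * exp (- x) \<and>
      (\<forall>\<omega>\<in>space P - B. \<forall>n\<in>{1..2*2^k}. \<forall>g\<in>hellinger_ball \<mu> f\<^sub>0 (\<M> q) (\<epsilon> k q j).
        (\<Sum>i=1..n. mid_log (g (X i \<omega>)))
          \<le> n * (\<integral>x. mid_log (g x) \<partial>\<nu>) + real (2 ^ k) * (\<epsilon> k q j)\<^sup>2 / 32)"
      by (rule chaining_deviation[OF K e0 pos 1 bracket_cover_of_bracketing_number[OF entropy[OF kq(2)]] x_eq x])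
    then obtain B where B: "B \<in> sets P" "prob B \<le> 2 * exp (- x)" "good k q j B"
      unfolding good_def by blast
    have "exp (- x) \<le> 1 / (real k)\<^sup>2 * (1 / 2) ^ q * (1 / 2) ^ j"
      unfolding x_def by (rule dyadic_tail_exponent[OF kq(1) q1 y[OF kq(2)]])
    then have "prob B \<le> 2 / (real k)\<^sup>2 * (1 / 2) ^ q * (1 / 2) ^ j"
      using B(2) by simp
    then show ?thesis using B by blast
  qed
  then obtain B where B: "\<And>k q j. B k q j \<in> sets P"
    and B_prob: "\<And>k q j. prob (B k q j) \<le> 2 / (real k)\<^sup>2 * (1 / 2) ^ q * (1 / 2) ^ j"
    and B_good: "\<And>k q j. good k q j (B k q j)"
    by metis
  define A where "A k = (\<Union>q j. B k q j)" for k
  have A: "A k \<in> sets P" for k unfolding A_def using B by auto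
  have A_prob: "prob (A k) \<le> 4 * (2 / (real k)\<^sup>2)" for k
    unfolding A_def by (rule prob_UN2_geometric_le[OF B _ B_prob]) simp
  have "summable (\<lambda>k. 4 * (2 / (real k)\<^sup>2))"
    using summable_mult[OF inverse_power_summable[of 2, where ?'a=real], of 8]
    by (simp add: divide_inverse)
  then have "summable (\<lambda>k. prob (A k))"
    by (rule summable_comparison_test'[of _ 0]) (use A_prob in simp)
  then have AE_A: "AE \<omega> in P. \<forall>\<^sub>F k in sequentially. \<omega> \<in> space P - A k"
    by (intro borel_cantelli_AE1 A) (simp_all add: less_top[symmetric])
  have "\<exists>k. 2 ^ k \<le> n \<and> n < 2 ^ (k + 1)" if "1 \<le> n" for n :: nat
    using ex_power_ivl1[of 2 n] that by auto
  then obtain ind where ind: "\<And>n :: nat. 1 \<le> n \<Longrightarrow> 2 ^ ind n \<le> n \<and> n < 2 ^ (ind n + 1)"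
    by metis
  have ind_ge: "k \<le> ind n" if "2 ^ k \<le> n" for k n
  proof (rule ccontr)
    assume "\<not> k \<le> ind n"
    then have "(2 :: nat) ^ (ind n + 1) \<le> 2 ^ k" by (intro power_increasing) auto
    moreover have "1 \<le> n" using that by (metis le_trans one_le_numeral one_le_power)
    ultimately show False using ind[of n] that by linarith
  qed
  have ind_lim: "filterlim ind at_top sequentially"
    unfolding filterlim_at_top eventually_sequentially using ind_ge by blast
  define G where "G n = (if 8 \<le> n then space P - A (ind n) else {})" for n
  have G: "G n \<in> sets P" for n using A by (simp add: G_def)
  have AE_G: "AE \<omega> in P. \<forall>\<^sub>F n in sequentially. \<omega> \<in> G n"
    using AE_A
  proof eventually_elim
    case (elim \<omega>)
    have "\<forall>\<^sub>F n in sequentially. \<omega> \<in> space P - A (ind n)"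
      using filterlim_iff ind_lim elim by blast
    then show ?case
      using eventually_ge_at_top[of 8] by eventually_elim (simp add: G_def)
  qed
  define C where "C = 25600 * c"
  have C0: "0 \<le> C" using c4 by (simp add: C_def)
  have "(\<Sum>i=1..n. mid_log (root_ratio f (X i \<omega>)))
         \<le> C * \<eta> q * (ln (ln n) + 1) - n * (hellinger \<mu> f f\<^sub>0)\<^sup>2 / 8"
    if \<omega>: "\<omega> \<in> G n" and q: "q\<^sub>0 \<le> q" and f: "f \<in> \<M> q" for n \<omega> q f
  proof -
    have n8: "8 \<le> n" and \<omega>A: "\<omega> \<in> space P - A (ind n)"
      using \<omega> by (auto simp: G_def split: if_splits)
    define k where "k = ind n"
    have k3: "3 \<le> k" using ind_ge[of 3 n] n8 by (simp add: k_def)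
    have kn: "2 ^ k \<le> n" "n < 2 ^ (k + 1)" using ind[of n] n8 by (auto simp: k_def)
    define h where "h = hellinger \<mu> f f\<^sub>0"
    have h0: "0 \<le> h" by (simp add: h_def hellinger_def)
    have fd: "pos_prob_density \<mu> f" using dens[OF q f] .
    have dev: "(\<Sum>i=1..n. mid_log (root_ratio f (X i \<omega>)))
        \<le> - (n * h\<^sup>2 / 4) + real (2 ^ k) * (\<epsilon> k q j)\<^sup>2 / 32" if "h \<le> \<epsilon> k q j" for j
    proof -
      have mem: "root_ratio f \<in> hellinger_ball \<mu> f\<^sub>0 (\<M> q) (\<epsilon> k q j)"
        using f that unfolding hellinger_ball_def h_def by blast
      have "\<omega> \<in> space P - B k q j" using \<omega>A by (auto simp: A_def k_def)
      moreover have "n \<in> {1..2*2^k}" using kn n8 by simp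
      moreover note mem
      ultimately have "(\<Sum>i=1..n. mid_log (root_ratio f (X i \<omega>)))
          \<le> n * (\<integral>x. mid_log (root_ratio f x) \<partial>\<nu>) + real (2 ^ k) * (\<epsilon> k q j)\<^sup>2 / 32"
        by (rule B_good[of k q j, unfolded good_def, rule_format, OF k3 q])
      moreover have "n * (\<integral>x. mid_log (root_ratio f x) \<partial>\<nu>) \<le> n * (- h\<^sup>2 / 4)"
        unfolding h_def by (intro mult_left_mono expectation_mid_log_le fd) simp
      ultimately show ?thesis by simp
    qed
    have \<eta>0: "0 \<le> \<eta> q" using eta[OF q] by simp
    have base: "real (2 ^ k) * (\<epsilon> k q 0)\<^sup>2 / 32 \<le> C * \<eta> q * (ln (ln n) + 1)"
    proof -
      have "real (2 ^ k) * (\<epsilon> k q 0)\<^sup>2 / 32 = C * \<eta> q * ln (real k)"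
        unfolding scale[OF k3 q] by (simp add: C_def)
      also have "\<dots> \<le> C * \<eta> q * (ln (ln n) + 1)"
        using C0 \<eta>0 k3 kn by (intro mult_left_mono ln_dyadic_index_le) auto
      finally show ?thesis .
    qed
    have base0: "0 \<le> C * \<eta> q * (ln (ln n) + 1)"
      using base by (rule order_trans[rotated]) simp
    have \<epsilon>_pos: "0 < \<epsilon> k q 0"
      using y[OF q] q q0 ln_k[OF k3] by (auto simp: \<epsilon>_def intro!: mult_pos_pos divide_pos_pos)
    have \<epsilon>_Suc: "\<epsilon> k q (Suc j) = 2 * \<epsilon> k q j" for j by (simp add: \<epsilon>_def)
    have \<epsilon>_eq: "\<epsilon> k q j = 2 ^ j * \<epsilon> k q 0" for j by (simp add: \<epsilon>_def)
    obtain j1 where "h / \<epsilon> k q 0 < 2 ^ j1" using real_arch_pow[of 2 "h / \<epsilon> k q 0"] by auto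
    then have "h \<le> \<epsilon> k q j1" using \<epsilon>_pos by (subst \<epsilon>_eq) (simp add: field_simps)
    \<comment> \<open>Outside the innermost ball \<open>\<epsilon> k q j\<close> is less than \<open>2 * h\<close>, so half of the drift absorbs the
      fluctuation; inside it the fluctuation is the \<open>ln (ln n)\<close> term.\<close>
    define j where "j = (LEAST j. h \<le> \<epsilon> k q j)"
    have hj: "h \<le> \<epsilon> k q j" unfolding j_def by (rule LeastI) fact
    have nh0: "0 \<le> n * h\<^sup>2" by simp
    show ?thesis
    proof (cases j)
      case 0
      show ?thesis using dev[OF hj] base nh0 unfolding h_def[symmetric] 0 by linarith
    next
      case (Suc i)
      then have "\<not> h \<le> \<epsilon> k q i" using not_less_Least[of i "\<lambda>j. h \<le> \<epsilon> k q j"] unfolding j_def by auto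
      then have "\<epsilon> k q j \<le> 2 * h" unfolding Suc \<epsilon>_Suc by simp
      moreover have "0 \<le> \<epsilon> k q j" using hj h0 by simp
      ultimately have "(\<epsilon> k q j)\<^sup>2 \<le> (2 * h)\<^sup>2" by (intro power_mono) auto
      moreover have "real (2 ^ k) \<le> real n" using kn(1) by (rule of_nat_mono)
      ultimately have "real (2 ^ k) * (\<epsilon> k q j)\<^sup>2 \<le> real n * (2 * h)\<^sup>2"
        by (intro mult_mono) auto
      then have "real (2 ^ k) * (\<epsilon> k q j)\<^sup>2 / 32 \<le> n * h\<^sup>2 / 8"
        by (simp add: power_mult_distrib)
      then show ?thesis using dev[OF hj] base0 unfolding h_def[symmetric] by linarith
    qed
  qed
  then show ?thesis using C0 G AE_G by blast
qed

section \<open>Consistency of the order estimator\<close>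

context density_sample
begin

lemma loglik_measurable [measurable]:
  "f \<in> borel_measurable \<mu> \<Longrightarrow> loglik X n f \<in> borel_measurable P"
  unfolding loglik_def[abs_def]
  by (intro borel_measurable_sum borel_measurable_ln measurable_compose[OF X_measurable]) auto

lemma sup_loglik_is_fam_esssup:
  assumes "\<And>f. f \<in> F \<Longrightarrow> pos_prob_density \<mu> f"
  shows "is_fam_esssup P F (\<lambda>f \<omega>. ereal (loglik X n f \<omega>)) (sup_loglik P X n F)"
  unfolding sup_loglik_def
proof (rule is_fam_esssup_fam_esssup)
  fix f assume "f \<in> F"
  then have [measurable]: "f \<in> borel_measurable \<mu>"
    using assms by (simp add: pos_prob_density_def)
  show "(\<lambda>\<omega>. ereal (loglik X n f \<omega>)) \<in> borel_measurable P" by measurable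
qed

lemma loglik_le_sup_loglik:
  assumes "\<And>f. f \<in> F \<Longrightarrow> pos_prob_density \<mu> f" "f \<in> F"
  shows "AE \<omega> in P. ereal (loglik X n f \<omega>) \<le> sup_loglik P X n F \<omega>"
  by (rule bspec[OF conjunct1[OF conjunct2[OF
        sup_loglik_is_fam_esssup[OF assms(1), unfolded is_fam_esssup_def]]] assms(2)])

text \<open>
  The bound on \<open>G\<close>, set to infinity elsewhere, is a measurable almost sure upper bound of each single
  log-likelihood, hence dominates their essential supremum. The null sets in which a density or
  its ratio degenerates may differ from one \<open>f\<close> to the next.
\<close>
lemma sup_loglik_le_on:
  assumes F: "\<And>f. f \<in> F \<Longrightarrow> pos_prob_density \<mu> f" and G [measurable]: "G \<in> sets P"
    and le: "\<And>\<omega> f. \<omega> \<in> G \<Longrightarrow> f \<in> F \<Longrightarrow> (\<Sum>i=1..n. mid_log (root_ratio f (X i \<omega>))) \<le> b"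
  shows "AE \<omega> in P. \<omega> \<in> G \<longrightarrow> sup_loglik P X n F \<omega> \<le> ereal (loglik X n f\<^sub>0 \<omega> + 4 * b)"
proof -
  define Y where "Y \<omega> = (if \<omega> \<in> G then ereal (loglik X n f\<^sub>0 \<omega> + 4 * b) else \<infinity>)" for \<omega>
  have "Y \<in> borel_measurable P"
    unfolding Y_def[abs_def] by measurable
  moreover have "AE \<omega> in P. ereal (loglik X n f \<omega>) \<le> Y \<omega>" if "f \<in> F" for f
    using loglik_le_sum_mid_log[OF F[OF that], of n]
  proof eventually_elim
    case (elim \<omega>)
    then show ?case using le[OF _ that, of \<omega>] by (auto simp: Y_def)
  qed
  ultimately have "AE \<omega> in P. sup_loglik P X n F \<omega> \<le> Y \<omega>"
    using sup_loglik_is_fam_esssup[OF F, where n=n] unfolding is_fam_esssup_def by blast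
  then show ?thesis by eventually_elim (simp add: Y_def split: if_splits)
qed

lemma hellinger_gap:
  assumes F: "\<And>f. f \<in> F \<Longrightarrow> pos_prob_density \<mu> f" and out: "f\<^sub>0 \<notin> L1_closure \<mu> F"
  shows "\<exists>a>0. \<forall>f\<in>F. a \<le> hellinger \<mu> f f\<^sub>0"
proof -
  obtain e where e: "0 < e" and far: "\<And>g. g \<in> F \<Longrightarrow> e \<le> (\<integral>x. \<bar>f\<^sub>0 x - g x\<bar> \<partial>\<mu>)"
    using out f0_density F unfolding L1_closure_def pos_prob_density_def by (auto simp: not_less)
  have "min 1 (e / 3) \<le> hellinger \<mu> f f\<^sub>0" if f: "f \<in> F" for f
  proof (rule ccontr)
    let ?h = "hellinger \<mu> f f\<^sub>0"
    assume "\<not> min 1 (e / 3) \<le> ?h"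
    then have h: "?h < 1" "?h < e / 3" by auto
    have "0 \<le> ?h" by (simp add: hellinger_def)
    then have "?h * ?h \<le> ?h * 1" using h by (intro mult_left_mono) auto
    then have "?h\<^sup>2 + 2 * ?h < e" using h by (simp add: power2_eq_square)
    then show False using L1_dist_le_hellinger[OF F[OF f]] far[OF f] by linarith
  qed
  then show ?thesis using e by (intro exI[of _ "min 1 (e / 3)"]) auto
qed

end

text \<open>
  As \<open>\<eta> (q\<^sub>0 + 1) \<le> \<eta> q\<close>, the gap \<open>\<eta> q - \<eta> q\<^sub>0\<close> is at least \<open>r * \<eta> q\<close> with
  \<open>r = 1 - \<eta> q\<^sub>0 / \<eta> (q\<^sub>0 + 1)\<close>; so the factor \<open>\<eta> q\<close> cancels and one threshold for \<open>n\<close> works for all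
  \<open>q\<close>.
\<close>
lemma overfit_margin:
  fixes \<eta> w :: "nat \<Rightarrow> real"
  assumes C: "0 \<le> C" and eta_pos: "\<And>q. q\<^sub>0 \<le> q \<Longrightarrow> 0 < \<eta> q"
    and mono: "\<And>q q'. q\<^sub>0 \<le> q \<Longrightarrow> q < q' \<Longrightarrow> \<eta> q < \<eta> q'"
    and w_pos: "\<And>n. 1 \<le> n \<Longrightarrow> 0 < w n"
    and w_lower: "(\<lambda>n. ln (ln (real n)) / w n) \<longlonglongrightarrow> 0"
  shows "\<forall>\<^sub>F n in sequentially. \<forall>q>q\<^sub>0. C * \<eta> q * (ln (ln n) + 1) < (\<eta> q - \<eta> q\<^sub>0) * w n"
proof -
  define r where "r = 1 - \<eta> q\<^sub>0 / \<eta> (q\<^sub>0 + 1)"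
  have r: "0 < r" using eta_pos[of "q\<^sub>0 + 1"] mono[of q\<^sub>0 "q\<^sub>0 + 1"] by (simp add: r_def)
  have "filterlim (\<lambda>n. ln (ln (real n))) at_top sequentially"
    by (intro filterlim_compose[OF ln_at_top] filterlim_real_sequentially)
  then have big: "\<forall>\<^sub>F n in sequentially. 1 \<le> ln (ln (real n))"
    by (simp add: filterlim_at_top)
  have "(\<lambda>n. 2 * C * (ln (ln (real n)) / w n)) \<longlonglongrightarrow> 2 * C * 0"
    by (intro tendsto_intros w_lower)
  then have "\<forall>\<^sub>F n in sequentially. 2 * C * (ln (ln (real n)) / w n) < r"
    using r by (intro order_tendstoD) auto
  then show ?thesis
    using big eventually_ge_at_top[of 1]
  proof eventually_elim
    case (elim n)
    have w: "0 < w n" using w_pos elim by simp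
    have "C * (ln (ln (real n)) + 1) \<le> C * (2 * ln (ln (real n)))"
      using C elim by (intro mult_left_mono) auto
    also have "\<dots> < r * w n" using elim w by (simp add: field_simps)
    finally have 1: "C * (ln (ln (real n)) + 1) < r * w n" .
    show ?case
    proof (intro allI impI)
      fix q assume q: "q\<^sub>0 < q"
      have p: "0 < \<eta> (q\<^sub>0 + 1)" "0 < \<eta> q" "0 < \<eta> q\<^sub>0" using eta_pos q by auto
      have "\<eta> (q\<^sub>0 + 1) \<le> \<eta> q"
        using mono[of "q\<^sub>0 + 1" q] q by (cases "q = q\<^sub>0 + 1") auto
      then have "\<eta> q\<^sub>0 * \<eta> (q\<^sub>0 + 1) \<le> \<eta> q\<^sub>0 * \<eta> q" using p by (intro mult_left_mono) auto
      then have "\<eta> q\<^sub>0 \<le> \<eta> q\<^sub>0 / \<eta> (q\<^sub>0 + 1) * \<eta> q" using p by (simp add: field_simps)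
      then have "\<eta> q * r \<le> \<eta> q - \<eta> q\<^sub>0" by (simp add: r_def algebra_simps)
      then have "\<eta> q * r * w n \<le> (\<eta> q - \<eta> q\<^sub>0) * w n" using w by (intro mult_right_mono) auto
      moreover have "\<eta> q * (C * (ln (ln (real n)) + 1)) < \<eta> q * (r * w n)"
        using 1 p by (intro mult_strict_left_mono)
      ultimately show "C * \<eta> q * (ln (ln n) + 1) < (\<eta> q - \<eta> q\<^sub>0) * w n"
        by (simp add: mult.assoc mult.left_commute)
    qed
  qed
qed

lemma underfit_margin:
  fixes w :: "nat \<Rightarrow> real"
  assumes a: "0 < a"
    and w_pos: "\<And>n. 1 \<le> n \<Longrightarrow> 0 < w n"
    and w_lower: "(\<lambda>n. ln (ln (real n)) / w n) \<longlonglongrightarrow> 0"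
    and w_upper: "(\<lambda>n. w n / real n) \<longlonglongrightarrow> 0"
  shows "\<forall>\<^sub>F n in sequentially. b * (ln (ln n) + 1) + c * w n < real n * a"
proof -
  have "(\<lambda>n. b * (ln (ln (real n)) / w n * (w n / real n) + 1 / real n) + c * (w n / real n))
      \<longlonglongrightarrow> b * (0 * 0 + 0) + c * 0"
    by (intro tendsto_intros w_lower w_upper lim_1_over_n)
  then have "\<forall>\<^sub>F n in sequentially.
      b * (ln (ln (real n)) / w n * (w n / real n) + 1 / real n) + c * (w n / real n) < a"
    using a by (intro order_tendstoD) auto
  then show ?thesis
    using eventually_ge_at_top[of 1]
  proof eventually_elim
    case (elim n)
    have w: "0 < w n" using w_pos elim by simp
    have n: "0 < real n" using elim by simp
    have "b * (ln (ln (real n)) + 1) + c * w n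
        = real n * (b * (ln (ln (real n)) / w n * (w n / real n) + 1 / real n) + c * (w n / real n))"
      using w n by (simp add: field_simps)
    also have "\<dots> < real n * a" using elim n by (intro mult_strict_left_mono)
    finally show ?case .
  qed
qed

lemma order_estimator_eq_singleton:
  assumes q0: "1 \<le> q\<^sub>0"
    and lower: "ereal L \<le> sup_loglik P X n (\<M> q\<^sub>0) \<omega>"
    and upper: "\<And>q. 1 \<le> q \<Longrightarrow> q \<noteq> q\<^sub>0 \<Longrightarrow> sup_loglik P X n (\<M> q) \<omega> \<le> ereal (L + b q)"
    and margin: "\<And>q. 1 \<le> q \<Longrightarrow> q \<noteq> q\<^sub>0 \<Longrightarrow> b q - pen n q < - pen n q\<^sub>0"
  shows "order_estimator P X \<M> pen n \<omega> = {q\<^sub>0}"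
proof -
  define V where "V q = sup_loglik P X n (\<M> q) \<omega> - ereal (pen n q)" for q
  have "V q < V q\<^sub>0" if q: "1 \<le> q" "q \<noteq> q\<^sub>0" for q
  proof -
    have "V q \<le> ereal (L + b q) - ereal (pen n q)"
      unfolding V_def by (intro ereal_minus_mono upper q order_refl)
    also have "\<dots> < ereal L - ereal (pen n q\<^sub>0)" using margin[OF q] by simp
    also have "\<dots> \<le> V q\<^sub>0"
      unfolding V_def by (intro ereal_minus_mono lower order_refl)
    finally show ?thesis .
  qed
  then have "is_arg_max V (\<lambda>q. 1 \<le> q) q \<longleftrightarrow> q = q\<^sub>0" for q
    unfolding is_arg_max_def using q0 by (metis less_asym less_irrefl)
  then show ?thesis unfolding order_estimator_def V_def by auto
qed

theorem corollary3p2: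
  fixes \<mu> :: "'a measure" and P :: "'w measure"
    and \<M> :: "nat \<Rightarrow> ('a \<Rightarrow> real) set" and f\<^sub>0 :: "'a \<Rightarrow> real" and q\<^sub>0 :: nat
    and X :: "nat \<Rightarrow> 'w \<Rightarrow> 'a"
    and K :: real and \<eta> :: "nat \<Rightarrow> real" and w :: "nat \<Rightarrow> real"
  assumes dens: "\<And>q f. 1 \<le> q \<Longrightarrow> f \<in> \<M> q \<Longrightarrow> pos_prob_density \<mu> f"
    and nested: "\<And>q. 1 \<le> q \<Longrightarrow> \<M> q \<subseteq> \<M> (q + 1)"
    and empty0: "\<M> 0 = {}"
    and q0: "1 \<le> q\<^sub>0"
    and f0: "f\<^sub>0 \<in> \<M> q\<^sub>0 - L1_closure \<mu> (\<M> (q\<^sub>0 - 1))"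
    and prob: "prob_space P"
    and indep: "prob_space.indep_vars P (\<lambda>_. \<mu>) X {1..}"
    and law: "\<And>k. 1 \<le> k \<Longrightarrow> distr P \<mu> (X k) = density \<mu> (\<lambda>x. ennreal (f\<^sub>0 x))"
    and K: "1 \<le> K"
    and eta_mono: "strict_mono_on {1..} \<eta>"
    and eta_ge: "\<And>q. 1 \<le> q \<Longrightarrow> real q \<le> \<eta> q"
    and entropy: "\<And>q \<epsilon> \<delta>. q\<^sub>0 \<le> q \<Longrightarrow> 0 < \<delta> \<Longrightarrow> \<delta> \<le> \<epsilon> \<Longrightarrow>
        ereal_of_enat (bracketing_number (density \<mu> (\<lambda>x. ennreal (f\<^sub>0 x)))
                         (hellinger_ball \<mu> f\<^sub>0 (\<M> q) \<epsilon>) \<delta>)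
          \<le> ereal ((K * \<epsilon> / \<delta>) powr \<eta> q)"
    and w_pos: "\<And>n. 1 \<le> n \<Longrightarrow> 0 < w n"
    and w_lower: "(\<lambda>n. ln (ln (real n)) / w n) \<longlonglongrightarrow> 0"
    and w_upper: "(\<lambda>n. w n / real n) \<longlonglongrightarrow> 0"
  shows "AE \<omega> in P. \<forall>\<^sub>F n in sequentially.
           order_estimator P X \<M> (\<lambda>n q. \<eta> q * w n) n \<omega> = {q\<^sub>0}"
proof -
  have f0_dens: "pos_prob_density \<mu> f\<^sub>0"
    using dens[OF q0] f0 by blast
  interpret density_sample P \<mu> f\<^sub>0 X
    using prob indep law f0_dens
    by (simp add: density_sample_def iid_sample_def iid_sample_axioms_def density_sample_axioms_def)
  have mono_M: "\<M> q \<subseteq> \<M> q'" if "1 \<le> q" "q \<le> q'" for q q'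
    using that(2)
  proof (induction rule: dec_induct)
    case (step m)
    then show ?case using nested[of m] that(1) by auto
  qed simp
  have f0_in: "f\<^sub>0 \<in> \<M> q" if "q\<^sub>0 \<le> q" for q
    using mono_M[OF q0 that] f0 by blast
  have dens': "pos_prob_density \<mu> f" if "q\<^sub>0 \<le> q" "f \<in> \<M> q" for q f
    using dens[of q f] that q0 by simp
  have eta': "real q \<le> \<eta> q" if "q\<^sub>0 \<le> q" for q using eta_ge[of q] that q0 by simp
  have eta_pos: "0 < \<eta> q" if "1 \<le> q" for q using eta_ge[OF that] that by linarith
  have "\<exists>C\<ge>0. \<exists>G. (\<forall>n. G n \<in> sets P) \<and> (AE \<omega> in P. \<forall>\<^sub>F n in sequentially. \<omega> \<in> G n) \<and>
    (\<forall>n. \<forall>\<omega>\<in>G n. \<forall>q\<ge>q\<^sub>0. \<forall>f\<in>\<M> q.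
       (\<Sum>i=1..n. mid_log (root_ratio f (X i \<omega>)))
         \<le> C * \<eta> q * (ln (ln n) + 1) - n * (hellinger \<mu> f f\<^sub>0)\<^sup>2 / 8)"
    by (rule likelihood_ratio_bound[OF q0 K]) (fact dens' eta' entropy)+
  then obtain C G where C: "0 \<le> C" and G_all: "\<forall>n. G n \<in> sets P"
    and AE_G: "AE \<omega> in P. \<forall>\<^sub>F n in sequentially. \<omega> \<in> G n"
    and bound_all: "\<forall>n. \<forall>\<omega>\<in>G n. \<forall>q\<ge>q\<^sub>0. \<forall>f\<in>\<M> q.
      (\<Sum>i=1..n. mid_log (root_ratio f (X i \<omega>)))
         \<le> C * \<eta> q * (ln (ln n) + 1) - n * (hellinger \<mu> f f\<^sub>0)\<^sup>2 / 8"
    by (elim exE conjE) (rule that)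
  note G = G_all[rule_format] and bound = bound_all[rule_format]
  have dens_pred: "pos_prob_density \<mu> f" if "f \<in> \<M> (q\<^sub>0 - 1)" for f
  proof (rule dens[OF _ that])
    show "1 \<le> q\<^sub>0 - 1" using that empty0 by (cases "q\<^sub>0 - 1") simp_all
  qed
  have "\<exists>a>0. \<forall>f\<in>\<M> (q\<^sub>0 - 1). a \<le> hellinger \<mu> f f\<^sub>0"
    using f0 by (intro hellinger_gap dens_pred) simp_all
  then obtain a where a: "0 < a" and gap: "\<And>f. f \<in> \<M> (q\<^sub>0 - 1) \<Longrightarrow> a \<le> hellinger \<mu> f f\<^sub>0"
    by blast
  define b where "b n q = (if q\<^sub>0 \<le> q then 4 * (C * \<eta> q * (ln (ln (real n)) + 1))
      else 4 * (C * \<eta> q\<^sub>0 * (ln (ln (real n)) + 1) - real n * a\<^sup>2 / 8))" for n q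
  have upper: "AE \<omega> in P. \<omega> \<in> G n \<longrightarrow>
      sup_loglik P X n (\<M> q) \<omega> \<le> ereal (loglik X n f\<^sub>0 \<omega> + b n q)" if q: "1 \<le> q" for n q
  proof -
    have "AE \<omega> in P. \<omega> \<in> G n \<longrightarrow>
      sup_loglik P X n (\<M> q) \<omega> \<le> ereal (loglik X n f\<^sub>0 \<omega> + 4 * (b n q / 4))"
    proof (rule sup_loglik_le_on[OF dens[OF q] G])
      fix \<omega> f assume \<omega>: "\<omega> \<in> G n" and f: "f \<in> \<M> q"
      show "(\<Sum>i=1..n. mid_log (root_ratio f (X i \<omega>))) \<le> b n q / 4"
      proof (cases "q\<^sub>0 \<le> q")
        case True
        have "0 \<le> n * (hellinger \<mu> f f\<^sub>0)\<^sup>2 / 8" by simp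
        then show ?thesis using bound[OF \<omega> True f] unfolding b_def if_P[OF True] by linarith
      next
        case False
        then have "q \<le> q\<^sub>0 - 1" "q \<le> q\<^sub>0" by arith+
        then have f': "f \<in> \<M> (q\<^sub>0 - 1)" "f \<in> \<M> q\<^sub>0"
          using mono_M[OF q] f by blast+
        have "real n * a\<^sup>2 \<le> n * (hellinger \<mu> f f\<^sub>0)\<^sup>2"
          using gap[OF f'(1)] a by (intro mult_left_mono power_mono) auto
        then show ?thesis using bound[OF \<omega> order_refl f'(2)] unfolding b_def if_not_P[OF False] by simp
      qed
    qed
    then show ?thesis by simp
  qed
  have "AE \<omega> in P. \<forall>n. \<forall>q\<in>{1..}. \<omega> \<in> G n \<longrightarrow>
      sup_loglik P X n (\<M> q) \<omega> \<le> ereal (loglik X n f\<^sub>0 \<omega> + b n q)"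
    unfolding AE_all_countable by (intro allI AE_ball_countable' upper) auto
  moreover have "AE \<omega> in P. \<forall>n. ereal (loglik X n f\<^sub>0 \<omega>) \<le> sup_loglik P X n (\<M> q\<^sub>0) \<omega>"
    using loglik_le_sup_loglik[OF dens[OF q0] f0_in[OF order_refl]] by (simp add: AE_all_countable)
  moreover note AE_G
  ultimately show ?thesis
  proof eventually_elim
    case (elim \<omega>)
    have over: "\<forall>\<^sub>F n in sequentially. \<forall>q>q\<^sub>0. 4 * C * \<eta> q * (ln (ln n) + 1) < (\<eta> q - \<eta> q\<^sub>0) * w n"
    proof (rule overfit_margin[OF _ _ _ w_pos w_lower])
      show "\<eta> q < \<eta> q'" if "q\<^sub>0 \<le> q" "q < q'" for q q'
        using that q0 by (intro strict_mono_onD[OF eta_mono]) auto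
    qed (use C eta_pos q0 in auto)
    have under: "\<forall>\<^sub>F n in sequentially.
        4 * C * \<eta> q\<^sub>0 * (ln (ln n) + 1) + \<eta> q\<^sub>0 * w n < real n * (a\<^sup>2 / 2)"
      by (rule underfit_margin[OF _ w_pos w_lower w_upper]) (use a in auto)
    show ?case
      using elim(3) over under eventually_ge_at_top[of 1]
    proof eventually_elim
      case (elim n)
      have w: "0 < w n" using w_pos elim by simp
      show ?case
      proof (rule order_estimator_eq_singleton[OF q0, where L="loglik X n f\<^sub>0 \<omega>" and b="b n"])
        show "ereal (loglik X n f\<^sub>0 \<omega>) \<le> sup_loglik P X n (\<M> q\<^sub>0) \<omega>"
          using \<open>\<forall>n. ereal _ \<le> _\<close> by blast
        fix q :: nat assume q: "1 \<le> q" "q \<noteq> q\<^sub>0"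
        show "sup_loglik P X n (\<M> q) \<omega> \<le> ereal (loglik X n f\<^sub>0 \<omega> + b n q)"
          using \<open>\<forall>n. \<forall>q\<in>{1..}. _\<close> q elim(1) by simp
        show "b n q - \<eta> q * w n < - (\<eta> q\<^sub>0 * w n)"
        proof (cases "q\<^sub>0 \<le> q")
          case True
          then have "4 * C * \<eta> q * (ln (ln n) + 1) < (\<eta> q - \<eta> q\<^sub>0) * w n" using elim(2) q by simp
          then show ?thesis using True by (simp add: b_def left_diff_distrib mult.assoc)
        next
          case False
          have "0 < \<eta> q * w n" using eta_pos[OF q(1)] w by simp
          moreover have "b n q = 4 * C * \<eta> q\<^sub>0 * (ln (ln n) + 1) - real n * (a\<^sup>2 / 2)"
            using False by (simp add: b_def right_diff_distrib)
          ultimately show ?thesis using elim(3) by simp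
        qed
      qed
    qed
  qed
qed

end
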